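(* Let $k\ge2$. Then the following identities hold: $$F_k(x,p,q,u,v,s,t)=1+\sum_{i=0}^{k-2}\big(f_{k,i}(x,p,q,u,v,s,t)+g_{k,i}(x,p,q,u,v,s,t)\big),$$ and, writing $f_{k,i}=f_{k,i}(x,p,q,u,v,s,t)$, $g_{k,i}=g_{k,i}(x,p,q,u,v,s,t)$, for $1\le i\le k-2$, \begin{align*} f_{k,i}=& pquvx^{i+1} X_i(p,q,u,1,s,t) \left(F_{k-i}(x,p,q,1,v,1,t) - 1\right) \\ &+pq^2uvx^{i+1} X_i(p,q,u,1,s,1) \left(F_{k-i}(x,p,q,1,v,1,1) - 1\right)\left(F_{k}(x,p,q,1,v,s,t)-1\right)\\ &+pq\left(F_{k-i}(x,p,q,1,v,1,1) - 1\right)\sum_{j=1}^{i-1}X_j(p,q,u,1,1,1) x^j f_{k,i-j}, \end{align*} \begin{align*} g_{k,i} =& puvtx^{i+1} X_i(p,q,u,1,s,t) + pquvx^{i+1} X_i(p,q,u,1,s,1) \left(F_k(x,p,q,1,v,s,t) - 1\right) \\ &+p^2quvx^{i+1} \sum_{j=1}^{i-1} X_j(p,q,u,1,1,1) X_{i-j}(p,q,u,1,s,t)\left(F_{k-i+j}(x,p,q,1,v,1,t) - 1\right) \\ &+pq\sum_{j=1}^{i-1} X_{j}(p,q,u,1,1,1) x^j \left(F_{k-i+j}(x,p,q,1,v,1,1) - 1\right)\left(g_{k,i-j}-puvtx^{i-j+1} X_{i-j}(p,q,u,1,s,t)\right), \end{align*} with initial conditions $f_{k,0}=uvstx+quvsx\left(F_k(x,p,q,1,v,s,t)-1\right)$,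 $g_{k,0}=0$, and $f_{2,0}=\frac{uvstx}{1-qvsx}$.
   Context: A permutation avoids a classical pattern $p$ if it has no subsequence order-isomorphic to $p$. For $k\ge1$, a permutation $\pi$ avoids the partially ordered pattern $P_k$ iff there are no indices $i_1<\cdots<i_k$ with $\pi_{i_j}<\pi_{i_k}$ for all $j<k$. Separable permutations are those avoiding $2413$ and $3142$ (the empty permutation included). For a permutation $\pi$, $\mathrm{asc},\mathrm{des}$ are the numbers of ascents and descents and $\mathrm{lrmax},\mathrm{rlmax},\mathrm{lrmin},\mathrm{rlmin}$ the numbers of left-to-right maxima, right-to-left maxima, left-to-right minima, right-to-left minima. Write $w(\pi)=p^{\mathrm{asc}(\pi)}q^{\mathrm{des}(\pi)}u^{\mathrm{lrmax}(\pi)}v^{\mathrm{rlmax}(\pi)}s^{\mathrm{lrmin}(\pi)}t^{\mathrm{rlmin}(\pi)}$. Define $F_k(x,p,q,u,v,s,t)=\sum_{n\ge0}x^n\sum_{\pi\in S_n(2413,3142,P_k)}w(\pi)$, and $X_n(p,q,u,v,s,t)=\sum_{\pi}w(\pi)$ over separable permutations $\pi$ of length $n$. For $0\le i\le k-2$, $f_{k,i}(x,p,q,u,v,s,t)=\sum_{n\ge1}x^n\sum_\pi w(\pi)$ where $\pi$ ranges over $S_n(2413,3142,P_k)$ having exactly $i$ entries to the left of $n$ and with $n-1$ (if $n\ge2$) to the right of $n$; $g_{k,i}(x,p,q,u,v,s,t)=\sum_{n\ge2}x^n\sum_\sigma w(\sigma)$ over $\sigma\in S_n(2413,3142,P_k)$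 with exactly $i$ entries to the left of $n$ and with $n-1$ to the left of $n$. Substituting a value (such as $1$) into an argument of $F_j$ or $X_j$ means evaluating the series at that value. *)

theory Defs
  imports
    "HOL-Library.Sublist"
    "HOL-Combinatorics.Multiset_Permutations"
    "HOL-Computational_Algebra.Formal_Power_Series"
begin

text \<open>
  Permutations of length \<open>n\<close> are written in one-line notation, as the lists in
  \<open>permutations_of_set {1..n}\<close>; positions in such a list are counted from 0.
\<close>

definition order_isomorphic :: "nat list \<Rightarrow> nat list \<Rightarrow> bool" where
  "order_isomorphic xs ys \<longleftrightarrow>
     length xs = length ys \<and>
     (\<forall>i < length xs. \<forall>j < length xs. xs ! i < xs ! j \<longleftrightarrow> ys ! i < ys ! j)"

definition avoids :: "nat list \<Rightarrow> nat list \<Rightarrow> bool" where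
  "avoids \<pi> \<tau> \<longleftrightarrow> \<not> (\<exists>zs. subseq zs \<pi> \<and> order_isomorphic zs \<tau>)"

definition avoids_P :: "nat \<Rightarrow> nat list \<Rightarrow> bool" where
  "avoids_P k \<pi> \<longleftrightarrow>
     \<not> (\<exists>h :: nat \<Rightarrow> nat. strict_mono_on {1..k} h \<and> h ` {1..k} \<subseteq> {..<length \<pi>} \<and>
          (\<forall>j \<in> {1..<k}. \<pi> ! h j < \<pi> ! h k))"

definition separable_perms :: "nat \<Rightarrow> nat list set" where
  "separable_perms n =
     {\<pi> \<in> permutations_of_set {1..n}. avoids \<pi> [2,4,1,3] \<and> avoids \<pi> [3,1,4,2]}"

definition separable_P_perms :: "nat \<Rightarrow> nat \<Rightarrow> nat list set" where
  "separable_P_perms k n = {\<pi> \<in> separable_perms n. avoids_P k \<pi>}"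

definition asc :: "nat list \<Rightarrow> nat" where
  "asc \<pi> = card {i. Suc i < length \<pi> \<and> \<pi> ! i < \<pi> ! Suc i}"

definition des :: "nat list \<Rightarrow> nat" where
  "des \<pi> = card {i. Suc i < length \<pi> \<and> \<pi> ! i > \<pi> ! Suc i}"

definition lrmax :: "nat list \<Rightarrow> nat" where
  "lrmax \<pi> = card {i. i < length \<pi> \<and> (\<forall>j < i. \<pi> ! j < \<pi> ! i)}"

definition rlmax :: "nat list \<Rightarrow> nat" where
  "rlmax \<pi> = card {i. i < length \<pi> \<and> (\<forall>j. i < j \<and> j < length \<pi> \<longrightarrow> \<pi> ! j < \<pi> ! i)}"

definition lrmin :: "nat list \<Rightarrow> nat" where
  "lrmin \<pi> = card {i. i < length \<pi> \<and> (\<forall>j < i. \<pi> ! j > \<pi> ! i)}"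

definition rlmin :: "nat list \<Rightarrow> nat" where
  "rlmin \<pi> = card {i. i < length \<pi> \<and> (\<forall>j. i < j \<and> j < length \<pi> \<longrightarrow> \<pi> ! j > \<pi> ! i)}"

definition weight ::
  "'a \<Rightarrow> 'a \<Rightarrow> 'a \<Rightarrow> 'a \<Rightarrow> 'a \<Rightarrow> 'a \<Rightarrow> nat list \<Rightarrow> 'a :: comm_ring_1" where
  "weight p q u v s t \<pi> =
     p ^ asc \<pi> * q ^ des \<pi> * u ^ lrmax \<pi> * v ^ rlmax \<pi> * s ^ lrmin \<pi> * t ^ rlmin \<pi>"

text \<open>
  The generating functions are formal power series in \<open>x\<close> (\<^const>\<open>fps_X\<close>). Their coefficients
  are integer polynomials in \<open>p, q, u, v, s, t\<close>, taken at arbitrary elements of a commutative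
  ring, so that replacing a variable by \<open>1\<close> is function application.
\<close>

definition X_poly ::
  "nat \<Rightarrow> 'a \<Rightarrow> 'a \<Rightarrow> 'a \<Rightarrow> 'a \<Rightarrow> 'a \<Rightarrow> 'a \<Rightarrow> 'a :: comm_ring_1" where
  "X_poly n p q u v s t = (\<Sum>\<pi> \<in> separable_perms n. weight p q u v s t \<pi>)"

definition F_gf ::
  "nat \<Rightarrow> 'a \<Rightarrow> 'a \<Rightarrow> 'a \<Rightarrow> 'a \<Rightarrow> 'a \<Rightarrow> 'a \<Rightarrow> 'a :: comm_ring_1 fps" where
  "F_gf k p q u v s t = Abs_fps (\<lambda>n. \<Sum>\<pi> \<in> separable_P_perms k n. weight p q u v s t \<pi>)"

text \<open>For a list \<open>\<pi>\<close>, exactly \<open>i\<close> entries precede \<open>n\<close> iff \<open>n\<close> is the entry at position \<open>i\<close>.\<close>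

definition f_gf ::
  "nat \<Rightarrow> nat \<Rightarrow> 'a \<Rightarrow> 'a \<Rightarrow> 'a \<Rightarrow> 'a \<Rightarrow> 'a \<Rightarrow> 'a \<Rightarrow> 'a :: comm_ring_1 fps" where
  "f_gf k i p q u v s t = Abs_fps (\<lambda>n. if n \<ge> 1 then
     (\<Sum>\<pi> | \<pi> \<in> separable_P_perms k n \<and> i < length \<pi> \<and> \<pi> ! i = n \<and>
            (n \<ge> 2 \<longrightarrow> (\<exists>j. i < j \<and> j < length \<pi> \<and> \<pi> ! j = n - 1)).
        weight p q u v s t \<pi>) else 0)"

definition g_gf ::
  "nat \<Rightarrow> nat \<Rightarrow> 'a \<Rightarrow> 'a \<Rightarrow> 'a \<Rightarrow> 'a \<Rightarrow> 'a \<Rightarrow> 'a \<Rightarrow> 'a :: comm_ring_1 fps" where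
  "g_gf k i p q u v s t = Abs_fps (\<lambda>n. if n \<ge> 2 then
     (\<Sum>\<pi> | \<pi> \<in> separable_P_perms k n \<and> i < length \<pi> \<and> \<pi> ! i = n \<and>
            (\<exists>j < i. \<pi> ! j = n - 1).
        weight p q u v s t \<pi>) else 0)"

end

theory Submission
  imports Defs
begin

text \<open>
  Write a permutation as \<open>A @ N # R\<close> with \<open>N\<close> its maximum. Avoiding 2413 forces the entries of \<open>R\<close>
  above \<open>max A\<close> to precede those below it, so they form a block of consecutive positions directly
  after \<open>N\<close> with the largest values below \<open>N\<close>; symmetrically, avoiding 3142 makes the entries of \<open>A\<close>
  above \<open>max R\<close> a block directly before \<open>N\<close>. Removing the block that contains \<open>N - 1\<close> is a bijection,
  because a block inserted next to \<open>N\<close> is an inflation of the maximum and 2413, 3142 are simple.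

  Removing the right block \<open>\<rho>\<close> of a permutation counted by \<open>f_{k,i}\<close> leaves one counted by
  \<open>g_{k,i}\<close>, while \<open>\<rho>\<close> only has to avoid \<open>P_{k-i}\<close>. Removing the left block, of length \<open>j\<close>, of one
  counted by \<open>g_{k,i}\<close> leaves one counted by \<open>f_{k,i-j}\<close>, and \<open>P_k\<close> imposes nothing on the block.
  The two mutual recursions, substituted into each other, are the stated identities; the special
  terms come from permutations that start or end with the block or with \<open>N\<close>, where the
  left-to-right or right-to-left minima and the descents change differently.
\<close>

section \<open>Statistics of concatenations\<close>

text \<open>Reversal exchanges the two sides for the patterns and the statistics but not for
  \<open>P_k\<close>, so the two blocks behave differently. \<open>P_k\<close> is read as a bound:
  no entry exceeds more than \<open>k - 2\<close> earlier entries. At the maximum this says that at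
  most \<open>k - 2\<close> entries precede it, which settles the bound for all of \<open>A\<close>.
  An entry of the right block exceeds every entry of \<open>A\<close>, so \<open>length A\<close> of
  its allowance is used up; entries on the far side of a block exceed nothing in it. Hence the right
  block has any length and contributes a series, while the left block has at most \<open>i\<close>
  entries and contributes a polynomial for each length \<open>j\<close>.

  The values 1 in the arguments record which extrema one piece hides in another. Minima depend on
  whether the maximum is first or last, so the permutations ending with the maximum are split off
  from \<open>g_{k,i}\<close>; they are the explicit term subtracted in the last sum. Substituting
  the first recursion at index \<open>i - j\<close> produces the \<open>F_{k-i+j}\<close> of the
  statement.\<close>

definition adjacent_count :: "(nat \<Rightarrow> nat \<Rightarrow> bool) \<Rightarrow> nat list \<Rightarrow> nat" where
  "adjacent_count R xs = card {i. Suc i < length xs \<and> R (xs ! i) (xs ! Suc i)}"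

lemma adjacent_count_Nil [simp]: "adjacent_count R [] = 0"
  and adjacent_count_single [simp]: "adjacent_count R [x] = 0"
  by (simp_all add: adjacent_count_def)

lemma adjacent_count_Cons_Cons [simp]:
  "adjacent_count R (x # y # zs) = (if R x y then 1 else 0) + adjacent_count R (y # zs)"
proof -
  have "{i. Suc i < length (x # y # zs) \<and> R ((x # y # zs) ! i) ((x # y # zs) ! Suc i)}
      = (if R x y then {0} else {}) \<union>
        Suc ` {i. Suc i < length (y # zs) \<and> R ((y # zs) ! i) ((y # zs) ! Suc i)}"
    (is "?L = ?Z \<union> Suc ` ?S")
  proof (rule set_eqI)
    fix i show "i \<in> ?L \<longleftrightarrow> i \<in> ?Z \<union> Suc ` ?S"
      by (cases i) auto
  qed
  moreover have "finite ?S"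
    by (rule finite_subset[of _ "{..<length (y # zs)}"]) auto
  moreover have "card (?Z \<union> Suc ` ?S) = card ?Z + card (Suc ` ?S)"
    by (rule card_Un_disjoint) (use \<open>finite ?S\<close> in \<open>auto split: if_splits\<close>)
  ultimately show ?thesis
    unfolding adjacent_count_def by (simp add: card_image)
qed

lemma adjacent_count_append:
  assumes "xs \<noteq> []" "ys \<noteq> []"
  shows "adjacent_count R (xs @ ys) =
    adjacent_count R xs + (if R (last xs) (hd ys) then 1 else 0) + adjacent_count R ys"
  using assms(1)
proof (induction xs rule: list_nonempty_induct)
  case (single x)
  then show ?case using assms(2) by (cases ys) auto
next
  case (cons x xs)
  then show ?case by (cases xs) auto
qed

lemma adjacent_count_map:
  assumes "\<And>x y. R (f x) (f y) \<longleftrightarrow> R x y"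
  shows "adjacent_count R (map f xs) = adjacent_count R xs"
  unfolding adjacent_count_def using assms by (intro arg_cong[where f = card]) auto

lemma asc_eq_adjacent_count: "asc = adjacent_count (<)"
  and des_eq_adjacent_count: "des = adjacent_count (>)"
  by (auto simp: fun_eq_iff asc_def des_def adjacent_count_def)

text \<open>The set \<open>S\<close> holds the entries already read, so that the count over a
  concatenation splits into two counts. All four extremum statistics are instances: \<open>R\<close>
  is \<open><\<close> or \<open>>\<close>, and the list is read forwards or backwards.\<close>

fun records_above :: "(nat \<Rightarrow> nat \<Rightarrow> bool) \<Rightarrow> nat set \<Rightarrow> nat list \<Rightarrow> nat" where
  "records_above R S [] = 0"
| "records_above R S (x # xs) =
     (if \<forall>y\<in>S. R y x then 1 else 0) + records_above R (insert x S) xs"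

lemma records_above_append:
  "records_above R S (xs @ ys) = records_above R S xs + records_above R (S \<union> set xs) ys"
  by (induction xs arbitrary: S) (auto simp: insert_commute)

lemma records_above_eq_0:
  assumes "\<And>x. x \<in> set xs \<Longrightarrow> \<exists>y\<in>S. \<not> R y x"
  shows "records_above R S xs = 0"
  using assms by (induction xs arbitrary: S) auto

lemma records_above_cong:
  assumes "\<And>x. x \<in> set xs \<Longrightarrow> (\<forall>y\<in>S. R y x) \<longleftrightarrow> (\<forall>y\<in>T. R y x)"
  shows "records_above R S xs = records_above R T xs"
  using assms
proof (induction xs arbitrary: S T)
  case (Cons x xs)
  have "records_above R (insert x S) xs = records_above R (insert x T) xs"
    by (rule Cons.IH) (use Cons.prems in auto)
  then show ?case using Cons.prems by simp
qed simp

lemma records_above_map: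
  assumes "\<And>x y. R (f x) (f y) \<longleftrightarrow> R x y"
  shows "records_above R (f ` S) (map f xs) = records_above R S xs"
proof (induction xs arbitrary: S)
  case (Cons x xs)
  have "records_above R (insert (f x) (f ` S)) (map f xs) = records_above R (insert x S) xs"
    using Cons.IH[of "insert x S"] by simp
  then show ?case by (simp add: assms)
qed simp

lemma card_records:
  "card {i. i < length xs \<and> (\<forall>j < i. R (xs ! j) (xs ! i))} = records_above R {} xs"
\<comment> \<open>A new last entry leaves the records before it as they are; a new first entry would
  not.\<close>
proof (induction xs rule: rev_induct)
  case (snoc x xs)
  have "{i. i < length (xs @ [x]) \<and> (\<forall>j < i. R ((xs @ [x]) ! j) ((xs @ [x]) ! i))}
    = {i. i < length xs \<and> (\<forall>j < i. R (xs ! j) (xs ! i))} \<union>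
      (if \<forall>y\<in>set xs. R y x then {length xs} else {})" (is "?L = ?S \<union> ?Z")
    by (auto simp: nth_append less_Suc_eq all_set_conv_all_nth split: if_splits)
  moreover have "card (?S \<union> ?Z) = card ?S + card ?Z"
    by (rule card_Un_disjoint) auto
  ultimately show ?case
    using snoc by (simp add: records_above_append)
qed simp

lemma card_records_rev:
  "card {i. i < length xs \<and> (\<forall>j. i < j \<and> j < length xs \<longrightarrow> R (xs ! j) (xs ! i))}
    = records_above R {} (rev xs)"
proof -
  let ?n = "length xs"
  \<comment> \<open>Reflecting the positions turns right-to-left records into left-to-right
    ones.\<close>
  have "bij_betw (\<lambda>i. ?n - 1 - i) {i. i < length (rev xs) \<and> (\<forall>j < i. R (rev xs ! j) (rev xs ! i))}
     {i. i < ?n \<and> (\<forall>j. i < j \<and> j < ?n \<longrightarrow> R (xs ! j) (xs ! i))}"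
  proof (rule bij_betwI[where g = "\<lambda>i. ?n - 1 - i"], goal_cases)
    case 1
    show ?case
    proof
      fix i assume "i \<in> {i. i < length (rev xs) \<and> (\<forall>j < i. R (rev xs ! j) (rev xs ! i))}"
      then have i: "i < ?n" and R: "\<And>j. j < i \<Longrightarrow> R (rev xs ! j) (rev xs ! i)" by auto
      have "R (xs ! j) (xs ! (?n - 1 - i))" if "?n - 1 - i < j" "j < ?n" for j
        using R[of "?n - 1 - j"] i that by (auto simp: rev_nth)
      then show "?n - 1 - i \<in> {i. i < ?n \<and> (\<forall>j. i < j \<and> j < ?n \<longrightarrow> R (xs ! j) (xs ! i))}"
        using i by auto
    qed
  next
    case 2
    show ?case
    proof
      fix i assume "i \<in> {i. i < ?n \<and> (\<forall>j. i < j \<and> j < ?n \<longrightarrow> R (xs ! j) (xs ! i))}"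
      then have i: "i < ?n" and R: "\<And>j. i < j \<Longrightarrow> j < ?n \<Longrightarrow> R (xs ! j) (xs ! i)" by auto
      have "R (rev xs ! j) (rev xs ! (?n - 1 - i))" if "j < ?n - 1 - i" for j
        using R[of "?n - 1 - j"] i that by (auto simp: rev_nth)
      then show "?n - 1 - i \<in> {i. i < length (rev xs) \<and> (\<forall>j < i. R (rev xs ! j) (rev xs ! i))}"
        using i by auto
    qed
  qed auto
  from bij_betw_same_card[OF this] show ?thesis
    by (simp only: card_records)
qed

lemma lrmax_eq_records: "lrmax xs = records_above (<) {} xs"
  and lrmin_eq_records: "lrmin xs = records_above (>) {} xs"
  and rlmax_eq_records: "rlmax xs = records_above (<) {} (rev xs)"
  and rlmin_eq_records: "rlmin xs = records_above (>) {} (rev xs)"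
  unfolding lrmax_def lrmin_def rlmax_def rlmin_def by (fact card_records card_records_rev)+

lemmas statistics_eqs = asc_eq_adjacent_count des_eq_adjacent_count
  lrmax_eq_records lrmin_eq_records rlmax_eq_records rlmin_eq_records

lemma weight_map_add: "weight p q u v s t (map ((+) c) xs) = weight p q u v s t xs"
  using records_above_map[of "(<)" "(+) c" "{}"] records_above_map[of "(>)" "(+) c" "{}"]
  by (simp add: weight_def statistics_eqs adjacent_count_map rev_map)

section \<open>Weights of words built around their maximum\<close>

definition below :: "nat list \<Rightarrow> nat list \<Rightarrow> bool" where
  "below xs ys \<longleftrightarrow> (\<forall>x\<in>set xs. \<forall>y\<in>set ys. x < y)"

lemma below_simps [simp]:
  "below [] ys" "below xs []"
  "below (x # xs) ys \<longleftrightarrow> (\<forall>y\<in>set ys. x < y) \<and> below xs ys"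
  "below xs (y # ys) \<longleftrightarrow> (\<forall>x\<in>set xs. x < y) \<and> below xs ys"
  "below (xs @ xs') ys \<longleftrightarrow> below xs ys \<and> below xs' ys"
  "below xs (ys @ ys') \<longleftrightarrow> below xs ys \<and> below xs ys'"
  "below (rev xs) ys \<longleftrightarrow> below xs ys" "below xs (rev ys) \<longleftrightarrow> below xs ys"
  by (auto simp: below_def)

lemma asc_des_append_less:
  assumes "xs \<noteq> []" "ys \<noteq> []" "last xs < hd ys"
  shows "asc (xs @ ys) = asc xs + asc ys + 1" "des (xs @ ys) = des xs + des ys"
  using assms by (simp_all add: statistics_eqs adjacent_count_append)

lemma asc_des_append_greater:
  assumes "xs \<noteq> []" "ys \<noteq> []" "hd ys < last xs"
  shows "asc (xs @ ys) = asc xs + asc ys" "des (xs @ ys) = des xs + des ys + 1"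
  using assms by (simp_all add: statistics_eqs adjacent_count_append)

lemma statistics_single [simp]:
  "asc [x] = 0" "des [x] = 0" "lrmax [x] = 1" "rlmax [x] = 1" "lrmin [x] = 1" "rlmin [x] = 1"
  by (simp_all add: statistics_eqs)

lemma statistics_Nil [simp]: "lrmax [] = 0" "rlmax [] = 0" "lrmin [] = 0" "rlmin [] = 0"
  by (simp_all add: statistics_eqs)

text \<open>The maximum hides everything behind it, and the entries before it keep their
  status.\<close>

lemma lrmax_max:
  assumes "below (A @ B) [N]"
  shows "lrmax (A @ N # B) = lrmax A + 1"
proof -
  have "records_above (<) (insert N (set A)) B = 0"
    using assms by (intro records_above_eq_0) (auto simp: ball_Un intro!: bexI[of _ N] dest: less_asym)
  then show ?thesis using assms by (simp add: statistics_eqs records_above_append ball_Un)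
qed

lemma rlmax_max: "below (A @ B) [N] \<Longrightarrow> rlmax (A @ N # B) = rlmax B + 1"
  using lrmax_max[of "rev B" "rev A" N] by (simp add: statistics_eqs ball_Un)

lemma lrmax_append_less:
  assumes "below A I"
  shows "lrmax (A @ I) = lrmax A + lrmax I"
proof -
  have "records_above (<) (set A) I = records_above (<) {} I"
    using assms by (intro records_above_cong) (auto simp: below_def)
  then show ?thesis by (simp add: statistics_eqs records_above_append)
qed

lemma rlmax_append_greater: "below B I \<Longrightarrow> rlmax (I @ B) = rlmax I + rlmax B"
  using lrmax_append_less[of "rev B" "rev I"] by (simp add: statistics_eqs)

lemma lrmin_append_greater:
  assumes "below B I"
  shows "lrmin (I @ B) = lrmin I + lrmin B"
proof -
  have "records_above (>) (set I) B = records_above (>) {} B"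
    using assms by (intro records_above_cong) (auto simp: below_def)
  then show ?thesis by (simp add: statistics_eqs records_above_append)
qed

lemma rlmin_append_less: "below A I \<Longrightarrow> rlmin (A @ I) = rlmin A + rlmin I"
  using lrmin_append_greater[of "rev A" "rev I"] by (simp add: statistics_eqs)

text \<open>Any one entry of \<open>A\<close> lies below all of \<open>I\<close>: it keeps the
  entries of \<open>I\<close> from being minima, and whatever \<open>I\<close> would exclude in
  \<open>B\<close> it excludes too. This breaks down for empty \<open>A\<close>, whence the separate
  weight lemmas for a block at either end.\<close>

lemma lrmin_block:
  assumes "A \<noteq> []" "below A I"
  shows "lrmin (A @ I @ B) = lrmin (A @ B)"
proof -
  obtain a where a: "a \<in> set A" using assms(1) by (cases A) auto
  then have I: "\<forall>y\<in>set I. a < y" using assms(2) by (simp add: below_def)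
  have "records_above (>) (set A) I = 0"
    using I a by (intro records_above_eq_0) (auto intro!: bexI[of _ a] dest: less_asym)
  moreover have "records_above (>) (set A \<union> set I) B = records_above (>) (set A) B"
    using I a by (intro records_above_cong) (auto intro: less_trans)
  ultimately show ?thesis by (simp add: statistics_eqs records_above_append)
qed

lemma rlmin_block: "B \<noteq> [] \<Longrightarrow> below B I \<Longrightarrow> rlmin (A @ I @ B) = rlmin (A @ B)"
  using lrmin_block[of "rev B" "rev I" "rev A"] by (simp add: statistics_eqs)

text \<open>\<open>N\<close> becomes the only right-to-left maximum, so \<open>A\<close> is weighed
  with \<open>v = 1\<close>. It adds an ascent, a left-to-right maximum and a right-to-left minimum,
  and leaves the left-to-right minima of the nonempty \<open>A\<close> alone.\<close>

lemma weight_snoc_max: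
  assumes "A \<noteq> []" "below A [N]"
  shows "weight p q u v s t (A @ [N]) = p * u * v * t * weight p q u 1 s t A"
proof -
  have ends: "last A < N"
    using assms by (simp_all add: below_def ball_Un)
  have "lrmin (A @ [N]) = lrmin A" using lrmin_block[of A "[N]" "[]"] assms by (simp_all add: ball_Un)
  moreover have "rlmin (A @ [N]) = rlmin A + 1" using rlmin_append_less[of A "[N]"] assms by (simp_all add: ball_Un)
  moreover have "lrmax (A @ [N]) = lrmax A + 1" "rlmax (A @ [N]) = 1"
    using lrmax_max[of A "[]" N] rlmax_max[of A "[]" N] assms by (simp_all add: ball_Un)
  moreover have "asc (A @ [N]) = asc A + 1" "des (A @ [N]) = des A"
    using asc_des_append_less[of A "[N]"] ends assms by (simp_all add: ball_Un)
  ultimately show ?thesis by (simp add: weight_def ac_simps)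
qed

lemma weight_Cons_max:
  assumes "B \<noteq> []" "below B [N]"
  shows "weight p q u v s t (N # B) = q * u * v * s * weight p q 1 v s t B"
proof -
  have ends: "hd B < N"
    using assms by (simp_all add: below_def ball_Un)
  have "rlmin (N # B) = rlmin B" using rlmin_block[of B "[N]" "[]"] assms by (simp_all add: ball_Un)
  moreover have "lrmin (N # B) = lrmin B + 1" using lrmin_append_greater[of B "[N]"] assms by (simp_all add: ball_Un)
  moreover have "lrmax (N # B) = 1" "rlmax (N # B) = rlmax B + 1"
    using lrmax_max[of "[]" B N] rlmax_max[of "[]" B N] assms by (simp_all add: ball_Un)
  moreover have "asc (N # B) = asc B" "des (N # B) = des B + 1"
    using asc_des_append_greater[of "[N]" B] ends assms by (simp_all add: ball_Un)
  ultimately show ?thesis by (simp add: weight_def ac_simps)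
qed

text \<open>\<open>N\<close> hides the maxima of either part from the other side, so
  \<open>v\<close> disappears from \<open>A\<close> and \<open>u\<close> from \<open>I\<close>. As
  \<open>I\<close> lies above \<open>A\<close>, none of its entries is a left-to-right minimum, but
  the right-to-left minima of both parts survive: \<open>t\<close> stays in both factors,
  \<open>s\<close> in one.\<close>

lemma weight_right_block_last:
  assumes "A \<noteq> []" "I \<noteq> []" "below A I" "below (A @ I) [N]"
  shows "weight p q u v s t (A @ N # I) =
    p * q * u * v * weight p q u 1 s t A * weight p q 1 v 1 t I"
proof -
  have ends: "last A < N" "hd I < N"
    using assms by (simp_all add: below_def ball_Un)
  have less: "below A (N # I)" using assms by simp
  have "lrmin (A @ N # I) = lrmin A"
    using lrmin_block[of A "N # I" "[]"] assms(1) less by (simp_all add: ball_Un)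
  moreover have "rlmin (A @ N # I) = rlmin A + rlmin (N # I)"
    using less by (rule rlmin_append_less)
  moreover have "rlmin (N # I) = rlmin I" using rlmin_block[of I "[N]" "[]"] assms by (simp_all add: ball_Un)
  moreover have "lrmax (A @ N # I) = lrmax A + 1" "rlmax (A @ N # I) = rlmax I + 1"
    using lrmax_max[of A I N] rlmax_max[of A I N] assms(4) by (simp_all add: ball_Un)
  moreover have "asc (A @ N # I) = asc A + asc (N # I) + 1" "des (A @ N # I) = des A + des (N # I)"
    using asc_des_append_less[of A "N # I"] ends assms by (simp_all add: ball_Un)
  moreover have "asc (N # I) = asc I" "des (N # I) = des I + 1"
    using asc_des_append_greater[of "[N]" I] ends assms by (simp_all add: ball_Un)
  ultimately show ?thesis by (simp add: weight_def power_add ac_simps)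
qed

text \<open>\<open>N # I\<close> takes the place of the single maximum \<open>m\<close>. The steps
  into \<open>N\<close> and from the block to \<open>B\<close> match those around \<open>m\<close>;
  the descent from \<open>N\<close> to \<open>I\<close> is the factor \<open>q\<close>. The minima
  are governed by \<open>A\<close> and \<open>B\<close>, so only \<open>v\<close> and the inner
  steps see the block.\<close>

lemma weight_right_block:
  assumes "A \<noteq> []" "I \<noteq> []" "B \<noteq> []" "below (A @ B) I" "below (A @ B @ I) [N]"
    "below (A @ B) [m]"
  shows "weight p q u v s t (A @ N # I @ B) =
    q * weight p q u v s t (A @ m # B) * weight p q 1 v 1 1 I"
proof -
  have ends: "last A < N" "last A < m" "hd I < N" "hd B < last I" "hd B < m"
    using assms by (simp_all add: below_def ball_Un)
  have "lrmin (A @ (N # I) @ B) = lrmin (A @ B)" "lrmin (A @ [m] @ B) = lrmin (A @ B)"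
    by (rule lrmin_block; use assms in \<open>simp add: ball_Un\<close>)+
  then have "lrmin (A @ N # I @ B) = lrmin (A @ m # B)" by simp
  moreover have "rlmin (A @ (N # I) @ B) = rlmin (A @ B)" "rlmin (A @ [m] @ B) = rlmin (A @ B)"
    by (rule rlmin_block; use assms in \<open>simp add: ball_Un\<close>)+
  then have "rlmin (A @ N # I @ B) = rlmin (A @ m # B)" by simp
  moreover have "lrmax (A @ N # I @ B) = lrmax (A @ m # B)"
    using assms lrmax_max[of A "I @ B" N] lrmax_max[of A B m] by (simp_all add: ball_Un)
  moreover have "rlmax (A @ N # I @ B) = rlmax (A @ m # B) + rlmax I"
    using assms rlmax_max[of A "I @ B" N] rlmax_max[of A B m] rlmax_append_greater[of B I] by (simp_all add: ball_Un)
  moreover have "asc (A @ N # I @ B) = asc (A @ m # B) + asc I"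
    "des (A @ N # I @ B) = des (A @ m # B) + des I + 1"
    using assms ends asc_des_append_less[of A "N # I @ B"] asc_des_append_less[of A "m # B"]
      asc_des_append_greater[of "[N]" "I @ B"] asc_des_append_greater[of "[m]" B]
      asc_des_append_greater[of I B] by (simp_all add: ball_Un)
  ultimately show ?thesis by (simp add: weight_def power_add ac_simps)
qed

text \<open>\<open>B\<close> lies below the leading block, so the left-to-right minima of both parts
  survive but only \<open>B\<close> has right-to-left minima: \<open>s\<close> stays in both
  factors, \<open>t\<close> in one. An ascent, a descent and both kinds of maxima come from
  \<open>N\<close>.\<close>

lemma weight_left_block_first:
  assumes "I \<noteq> []" "B \<noteq> []" "below B I" "below (B @ I) [N]"
  shows "weight p q u v s t (I @ N # B) =
    p * q * u * v * weight p q u 1 s 1 I * weight p q 1 v s t B"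
proof -
  have ends: "last I < N" "hd B < N"
    using assms by (simp_all add: below_def ball_Un)
  have "rlmin ([] @ (I @ [N]) @ B) = rlmin ([] @ B)"
    by (rule rlmin_block) (use assms in \<open>simp_all add: ball_Un\<close>)
  then have "rlmin (I @ N # B) = rlmin B" by simp
  moreover have "lrmin (I @ [N] @ B) = lrmin (I @ B)"
    by (rule lrmin_block) (use assms in \<open>simp_all add: ball_Un\<close>)
  then have "lrmin (I @ N # B) = lrmin I + lrmin B"
    using lrmin_append_greater[of B I] assms by (simp_all add: ball_Un)
  moreover have "lrmax (I @ N # B) = lrmax I + 1" "rlmax (I @ N # B) = rlmax B + 1"
    using lrmax_max[of I B N] rlmax_max[of I B N] assms(4) by (simp_all add: ball_Un)
  moreover have "asc (I @ N # B) = asc I + asc B + 1" "des (I @ N # B) = des I + des B + 1"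
    using assms ends asc_des_append_greater[of "I @ [N]" B] asc_des_append_less[of I "[N]"] by (simp_all add: ball_Un)
  ultimately show ?thesis by (simp add: weight_def power_add ac_simps)
qed

text \<open>\<open>I @ [N]\<close> takes the place of the single maximum \<open>m\<close>. The only
  step without a counterpart there is the ascent from the block to \<open>N\<close>, the factor
  \<open>p\<close>.\<close>

lemma weight_left_block:
  assumes "A \<noteq> []" "I \<noteq> []" "B \<noteq> []" "below (A @ B) I" "below (A @ B @ I) [N]"
    "below (A @ B) [m]"
  shows "weight p q u v s t (A @ I @ N # B) =
    p * weight p q u 1 1 1 I * weight p q u v s t (A @ m # B)"
proof -
  have ends: "last A < hd I" "last A < m" "last I < N" "hd B < N" "hd B < m"
    using assms by (simp_all add: below_def ball_Un)
  have "lrmin (A @ (I @ [N]) @ B) = lrmin (A @ B)" "lrmin (A @ [m] @ B) = lrmin (A @ B)"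
    by (rule lrmin_block; use assms in \<open>simp add: ball_Un\<close>)+
  then have "lrmin (A @ I @ N # B) = lrmin (A @ m # B)" by simp
  moreover have "rlmin (A @ (I @ [N]) @ B) = rlmin (A @ B)" "rlmin (A @ [m] @ B) = rlmin (A @ B)"
    by (rule rlmin_block; use assms in \<open>simp add: ball_Un\<close>)+
  then have "rlmin (A @ I @ N # B) = rlmin (A @ m # B)" by simp
  moreover have "rlmax (A @ I @ N # B) = rlmax (A @ m # B)"
    using assms rlmax_max[of "A @ I" B N] rlmax_max[of A B m] by (simp_all add: ball_Un)
  moreover have "lrmax (A @ I @ N # B) = lrmax (A @ m # B) + lrmax I"
    using assms lrmax_max[of "A @ I" B N] lrmax_max[of A B m] lrmax_append_less[of A I] by (simp_all add: ball_Un)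
  moreover have "asc (A @ I @ N # B) = asc (A @ m # B) + asc I + 1"
    "des (A @ I @ N # B) = des (A @ m # B) + des I"
    using assms ends asc_des_append_less[of A "I @ [N]"] asc_des_append_less[of A "[m]"] asc_des_append_less[of I "[N]"]
      asc_des_append_greater[of "A @ I @ [N]" "B"] asc_des_append_greater[of "A @ [m]" B] by (simp_all add: ball_Un)
  ultimately show ?thesis by (simp add: weight_def power_add ac_simps)
qed

section \<open>Generating functions of sets of words\<close>

definition gf :: "(nat list \<Rightarrow> 'a) \<Rightarrow> nat list set \<Rightarrow> 'a :: comm_ring_1 fps" where
  "gf W S = Abs_fps (\<lambda>n. \<Sum>\<pi> | \<pi> \<in> S \<and> length \<pi> = n. W \<pi>)"

text \<open>Guards against the value 0 that \<open>sum\<close> takes on an infinite set, which would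
  break the additivity of \<open>gf\<close>.\<close>

definition graded_finite :: "nat list set \<Rightarrow> bool" where
  "graded_finite S \<longleftrightarrow> (\<forall>n. finite {\<pi> \<in> S. length \<pi> = n})"

lemma graded_finite_subset: "graded_finite T \<Longrightarrow> S \<subseteq> T \<Longrightarrow> graded_finite S"
  unfolding graded_finite_def
proof
  fix n assume "\<forall>n. finite {\<pi> \<in> T. length \<pi> = n}" "S \<subseteq> T"
  then show "finite {\<pi> \<in> S. length \<pi> = n}"
    by (intro finite_subset[of "{\<pi> \<in> S. length \<pi> = n}" "{\<pi> \<in> T. length \<pi> = n}"]) auto
qed

lemma gf_Un:
  assumes "graded_finite S" "graded_finite T" "S \<inter> T = {}"
  shows "gf W (S \<union> T) = gf W S + gf W T"
proof (rule fps_ext)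
  fix n
  have "{\<pi>. \<pi> \<in> S \<union> T \<and> length \<pi> = n} = {\<pi> \<in> S. length \<pi> = n} \<union> {\<pi> \<in> T. length \<pi> = n}" by auto
  moreover have "(\<Sum>\<pi> \<in> {\<pi> \<in> S. length \<pi> = n} \<union> {\<pi> \<in> T. length \<pi> = n}. W \<pi>)
      = (\<Sum>\<pi> \<in> {\<pi> \<in> S. length \<pi> = n}. W \<pi>) + (\<Sum>\<pi> \<in> {\<pi> \<in> T. length \<pi> = n}. W \<pi>)"
    using assms by (intro sum.union_disjoint) (auto simp: graded_finite_def)
  ultimately show "fps_nth (gf W (S \<union> T)) n = fps_nth (gf W S + gf W T) n"
    by (simp add: gf_def)
qed

lemma gf_empty [simp]: "gf W {} = 0"
  by (rule fps_ext) (simp add: gf_def)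

lemma gf_singleton: "gf W {\<pi>} = fps_const (W \<pi>) * fps_X ^ length \<pi>"
proof (rule fps_ext)
  fix n
  have "{\<rho>. \<rho> \<in> {\<pi>} \<and> length \<rho> = n} = (if n = length \<pi> then {\<pi>} else {})" by auto
  then show "fps_nth (gf W {\<pi>}) n = fps_nth (fps_const (W \<pi>) * fps_X ^ length \<pi>) n"
    by (simp add: gf_def)
qed

lemma gf_UN:
  assumes "finite I" "graded_finite (\<Union>i\<in>I. S i)"
    "\<And>i j. i \<in> I \<Longrightarrow> j \<in> I \<Longrightarrow> i \<noteq> j \<Longrightarrow> S i \<inter> S j = {}"
  shows "gf W (\<Union>i\<in>I. S i) = (\<Sum>i\<in>I. gf W (S i))"
  using assms
proof (induction I rule: finite_induct)
  case (insert i I)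
  have "gf W (S i \<union> (\<Union>i\<in>I. S i)) = gf W (S i) + gf W (\<Union>i\<in>I. S i)"
    by (intro gf_Un; (rule graded_finite_subset[OF insert.prems(1)])?)
      (use insert.prems(2)[of i] insert.hyps in blast)+
  moreover have "gf W (\<Union>i\<in>I. S i) = (\<Sum>i\<in>I. gf W (S i))"
    by (intro insert.IH graded_finite_subset[OF insert.prems(1)] insert.prems(2)) auto
  ultimately show ?case using insert.hyps by simp
qed simp

text \<open>The Cauchy product, for an assembly \<open>h\<close> that adds \<open>d\<close> entries
  and is multiplicative up to the constant \<open>c\<close>. The three weights are independent
  because the two components are usually weighed with some variables set to 1.\<close>

lemma gf_prod:
  assumes bij: "bij_betw (\<lambda>(\<alpha>, \<beta>). h \<alpha> \<beta>) (S \<times> T) U"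
    and fin: "graded_finite S" "graded_finite T"
    and len: "\<And>\<alpha> \<beta>. \<alpha> \<in> S \<Longrightarrow> \<beta> \<in> T \<Longrightarrow> length (h \<alpha> \<beta>) = d + length \<alpha> + length \<beta>"
    and W: "\<And>\<alpha> \<beta>. \<alpha> \<in> S \<Longrightarrow> \<beta> \<in> T \<Longrightarrow> W (h \<alpha> \<beta>) = c * W1 \<alpha> * W2 \<beta>"
  shows "gf W U = fps_const c * fps_X ^ d * gf W1 S * gf W2 T"
proof (rule fps_ext)
  fix n
  define S' where "S' m = {\<alpha> \<in> S. length \<alpha> = m}" for m
  define T' where "T' m = {\<beta> \<in> T. length \<beta> = m}" for m
  have fin': "finite (S' m)" "finite (T' m)" for m
    using fin by (auto simp: S'_def T'_def graded_finite_def)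
  define U' where "U' = {\<pi> \<in> U. length \<pi> = n}"
  define Q where "Q = {z \<in> S \<times> T. d + length (fst z) + length (snd z) = n}"
  have "bij_betw (\<lambda>(\<alpha>, \<beta>). h \<alpha> \<beta>) Q U'"
    using bij len unfolding bij_betw_def Q_def U'_def inj_on_def by fastforce
  then have "fps_nth (gf W U) n = (\<Sum>(\<alpha>, \<beta>)\<in>Q. W (h \<alpha> \<beta>))"
    unfolding gf_def U'_def
    by (simp add: sum.reindex_bij_betw[symmetric] case_prod_unfold)
  also have "\<dots> = (\<Sum>(\<alpha>, \<beta>)\<in>Q. c * W1 \<alpha> * W2 \<beta>)"
    using W by (intro sum.cong) (auto simp: Q_def)
  also have "\<dots> = fps_nth (fps_const c * fps_X ^ d * gf W1 S * gf W2 T) n"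
  proof (cases "n < d")
    case True
    then have "Q = {}" by (auto simp: Q_def)
    then show ?thesis using True
      by (simp add: mult.assoc fps_X_power_mult_nth)
  next
    case False
    then have Q: "Q = (\<Union>m\<in>{0..n - d}. S' m \<times> T' (n - d - m))"
      by (auto simp: Q_def S'_def T'_def)
    have "(\<Sum>(\<alpha>, \<beta>)\<in>Q. c * W1 \<alpha> * W2 \<beta>) =
        (\<Sum>m=0..n - d. \<Sum>(\<alpha>, \<beta>)\<in>S' m \<times> T' (n - d - m). c * W1 \<alpha> * W2 \<beta>)"
      unfolding Q by (intro sum.UNION_disjoint) (auto simp: fin', auto simp: S'_def)
    also have "\<dots> = (\<Sum>m=0..n - d. c * ((\<Sum>\<alpha>\<in>S' m. W1 \<alpha>) * (\<Sum>\<beta>\<in>T' (n - d - m). W2 \<beta>)))"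
      by (intro sum.cong refl)
        (simp only: sum.cartesian_product[symmetric] sum_product, simp only: sum_distrib_left mult.assoc)
    also have "\<dots> = c * fps_nth (gf W1 S * gf W2 T) (n - d)"
      by (simp add: fps_mult_nth gf_def S'_def T'_def sum_distrib_left)
    finally show ?thesis using False
      by (simp add: mult.assoc fps_X_power_mult_nth)
  qed
  finally show "fps_nth (gf W U) n = fps_nth (fps_const c * fps_X ^ d * gf W1 S * gf W2 T) n" .
qed

section \<open>Pattern avoidance and blocks of largest values\<close>

definition separable :: "nat list \<Rightarrow> bool" where
  "separable xs \<longleftrightarrow> avoids xs [2,4,1,3] \<and> avoids xs [3,1,4,2]"

lemma order_isomorphic_2413:
  "order_isomorphic zs [2,4,1,3] \<longleftrightarrow> (\<exists>a b c d. zs = [b,d,a,c] \<and> a < b \<and> b < c \<and> c < d)"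
proof
  assume iso: "order_isomorphic zs [2,4,1,3]"
  then have "length zs = Suc (Suc (Suc (Suc 0)))" by (simp add: order_isomorphic_def)
  then obtain b d a c where zs: "zs = [b,d,a,c]" by (auto simp: length_Suc_conv)
  from iso have "a < b \<and> b < c \<and> c < d"
    unfolding order_isomorphic_def zs
    by (simp add: All_less_Suc2 numeral_eq_Suc)
  then show "\<exists>a b c d. zs = [b,d,a,c] \<and> a < b \<and> b < c \<and> c < d" using zs by blast
next
  assume "\<exists>a b c d. zs = [b,d,a,c] \<and> a < b \<and> b < c \<and> c < d"
  then show "order_isomorphic zs [2,4,1,3]"
    by (elim exE conjE) (simp add: order_isomorphic_def All_less_Suc2 numeral_eq_Suc)
qed

lemma order_isomorphic_3142:
  "order_isomorphic zs [3,1,4,2] \<longleftrightarrow> (\<exists>a b c d. zs = [c,a,d,b] \<and> a < b \<and> b < c \<and> c < d)"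
proof
  assume iso: "order_isomorphic zs [3,1,4,2]"
  then have "length zs = Suc (Suc (Suc (Suc 0)))" by (simp add: order_isomorphic_def)
  then obtain c a d b where zs: "zs = [c,a,d,b]" by (auto simp: length_Suc_conv)
  from iso have "a < b \<and> b < c \<and> c < d"
    unfolding order_isomorphic_def zs
    by (simp add: All_less_Suc2 numeral_eq_Suc)
  then show "\<exists>a b c d. zs = [c,a,d,b] \<and> a < b \<and> b < c \<and> c < d" using zs by blast
next
  assume "\<exists>a b c d. zs = [c,a,d,b] \<and> a < b \<and> b < c \<and> c < d"
  then show "order_isomorphic zs [3,1,4,2]"
    by (elim exE conjE) (simp add: order_isomorphic_def All_less_Suc2 numeral_eq_Suc)
qed

lemma separableI:
  assumes "\<And>zs a b c d. subseq zs xs \<Longrightarrow> a < b \<Longrightarrow> b < c \<Longrightarrow> c < d \<Longrightarrow>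
    zs = [b,d,a,c] \<or> zs = [c,a,d,b] \<Longrightarrow> False"
  shows "separable xs"
  unfolding separable_def avoids_def order_isomorphic_2413 order_isomorphic_3142
  by (intro conjI notI; elim exE conjE) (rule assms, assumption+, simp)+

lemma separableD:
  assumes "separable xs" "subseq zs xs" "a < b" "b < c" "c < d" "zs = [b,d,a,c] \<or> zs = [c,a,d,b]"
  shows False
  using assms unfolding separable_def avoids_def order_isomorphic_2413 order_isomorphic_3142
  by blast

lemma separable_subseq:
  assumes "separable ys" "subseq xs ys"
  shows "separable xs"
proof (rule separableI)
  fix zs a b c d assume "subseq zs xs" "a < b" "b < c" "c < d" "zs = [b,d,a,c] \<or> zs = [c,a,d,b]"
  moreover have "subseq zs ys" using \<open>subseq zs xs\<close> assms(2) by (rule subseq_order.order_trans)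
  ultimately show False by (intro separableD[OF assms(1)])
qed

lemma separable_map_add: "separable (map ((+) n) xs) \<longleftrightarrow> separable xs"
proof
  assume sep: "separable (map ((+) n) xs)"
  show "separable xs"
  proof (rule separableI)
    fix zs a b c d assume *: "subseq zs xs" "a < b" "b < c" "c < d" "zs = [b,d,a,c] \<or> zs = [c,a,d,b]"
    show False
      by (rule separableD[OF sep subseq_map[OF *(1)], of "n + a" "n + b" "n + c" "n + d"])
        (use *(2-) in auto)
  qed
next
  assume sep: "separable xs"
  show "separable (map ((+) n) xs)"
  proof (rule separableI)
    fix zs a b c d assume *: "subseq zs (map ((+) n) xs)" "a < b" "b < c" "c < d"
      "zs = [b,d,a,c] \<or> zs = [c,a,d,b]"
    from *(1) obtain ws where ws: "subseq ws xs" "zs = map ((+) n) ws"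
      unfolding subseq_conv_nths nths_map by blast
    \<comment> \<open>Truncated subtraction is harmless here: every entry of \<open>zs\<close> is at
      least \<open>n\<close>, so strict inequalities are kept.\<close>
    have "map (\<lambda>z. z - n) zs = ws" by (simp add: ws(2) o_def)
    moreover have "\<forall>z\<in>set zs. n \<le> z" by (simp add: ws(2))
    ultimately show False
      by (intro separableD[OF sep ws(1), of "a - n" "b - n" "c - n" "d - n"]) (use *(2-) in auto)
  qed
qed

lemma subseq_memD: "subseq xs ys \<Longrightarrow> x \<in> set xs \<Longrightarrow> x \<in> set ys"
  by (auto elim: list_emb_set)

text \<open>The patterns 2413 and 3142 are simple, so an occurrence meets a block of consecutive
  positions that carries the largest values either in at most one entry or entirely.\<close>

lemma separable_inflate:
  assumes AB: "\<And>x y. x \<in> set A \<union> set B \<Longrightarrow> y \<in> set I \<Longrightarrow> x < y"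
    and c: "\<And>x. x \<in> set A \<union> set B \<Longrightarrow> x < c"
    and I: "separable I" and sep: "separable (A @ c # B)"
  shows "separable (A @ I @ B)"
proof (rule separableI)
  fix zs a1 a2 a3 a4
  assume that: "subseq zs (A @ I @ B)" "a1 < a2" "a2 < a3" "a3 < a4"
    "zs = [a2, a4, a1, a3] \<or> zs = [a3, a1, a4, a2]"
  show False
  proof -
    from that(1) obtain z1 z2 z3 where zs: "zs = z1 @ z2 @ z3"
      and sub: "subseq z1 A" "subseq z2 I" "subseq z3 B"
      by (auto simp: subseq_append_iff)
    have len: "length zs = 4" using that(5) by auto
    have mem: "x < y" if "x \<in> set z1 \<union> set z3" "y \<in> set z2" for x y
      using AB[of x y] sub that by (auto dest: subseq_memD)
    have memc: "x < c" if "x \<in> set z1 \<union> set z3" for x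
      using c[of x] sub that by (auto dest: subseq_memD)
    have sub0: "subseq (z1 @ c # z3) (A @ c # B)" "subseq (z1 @ z3) (A @ c # B)"
      using sub by (auto intro!: list_emb_append_mono)
    consider "z2 = []" | y where "z2 = [y]" | x y ys where "z2 = x # y # ys"
      by (cases z2; cases "tl z2") auto
    then show False
    proof cases
      case 1
      then have "subseq zs (A @ c # B)" using zs sub0 by simp
      then show False using that(2-) by (rule separableD[OF sep])
    next
      case 2
      then have z: "zs = z1 @ y # z3" using zs by simp
      \<comment> \<open>The single entry taken from the block is the largest of the occurrence. It
        therefore plays the 4, and \<open>c\<close> can play it instead.\<close>
      have y: "x \<le> y" if "x \<in> set zs" for x
        using that z mem[of x y] 2 by auto
      have "a4 \<in> set zs" using that(5) by auto
      then have "a4 \<le> y" by (rule y)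
      moreover have "y \<in> set zs" using z by simp
      then have "y \<le> a4" using that(2-) by auto
      ultimately have "y = a4" by simp
      have z13: "z1 = [a2] \<and> z3 = [a1, a3] \<or> z1 = [a3, a1] \<and> z3 = [a2]"
      proof -
        define i where "i = length z1"
        have i: "z1 = take i zs" "zs ! i = a4" "z3 = drop (Suc i) zs" "i < length zs"
          using z \<open>y = a4\<close> by (simp_all add: i_def)
        then have "i = 0 \<or> i = 1 \<or> i = 2 \<or> i = 3"
          using len by arith
        then show ?thesis using that(2-) i by (elim disjE) auto
      qed
      then have "a3 < c" using memc by auto
      with z13 show False
        by (intro separableD[OF sep sub0(1) that(2,3)]) auto
    next
      case 3
      define i j where "i = length z1" and "j = length z2"
      have ij: "z1 = take i zs" "z2 = take j (drop i zs)" "z3 = drop (i + j) zs"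
        "i + j \<le> length zs" "2 \<le> j"
        using zs 3 by (simp_all add: i_def j_def)
      \<comment> \<open>These are the six places for a segment of at least two of the four entries.
        Only the whole survives: in neither pattern do the two or the three largest values occupy
        consecutive positions.\<close>
      then have "i = 0 \<and> j = 2 \<or> i = 0 \<and> j = 3 \<or> i = 0 \<and> j = 4 \<or> i = 1 \<and> j = 2 \<or>
          i = 1 \<and> j = 3 \<or> i = 2 \<and> j = 2"
        using len by arith
      moreover have "\<forall>x\<in>set z1 \<union> set z3. \<forall>y\<in>set z2. x < y" using mem by blast
      ultimately have "z1 = [] \<and> z3 = []"
        using that(2-) unfolding ij(1-3) by (elim disjE conjE) auto
      then have "subseq zs I" using sub zs by simp
      then show False using that(2-) by (rule separableD[OF I])
    qed
  qed
qed

text \<open>The first entry of the block represents it in a subsequence; inflating that entry by the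
  word \<open>[c]\<close> renames it to \<open>c\<close>.\<close>

lemma separable_deflate:
  assumes sep: "separable (A @ I @ B)" and "I \<noteq> []"
    and AB: "\<And>x y. x \<in> set A \<union> set B \<Longrightarrow> y \<in> set I \<Longrightarrow> x < y"
    and c: "\<And>x. x \<in> set A \<union> set B \<Longrightarrow> x < c"
  shows "separable (A @ c # B)"
proof -
  have "separable (A @ hd I # B)"
    by (rule separable_subseq[OF sep]) (use \<open>I \<noteq> []\<close> in \<open>auto intro!: list_emb_append_mono
        simp: neq_Nil_conv\<close>)
  moreover have "separable [c]"
    by (rule separableI) (auto dest: list_emb_length)
  ultimately show ?thesis
    using separable_inflate[of A B "[c]" "hd I"] AB c \<open>I \<noteq> []\<close> by auto
qed

text \<open>Neither pattern begins with its 4, so \<open>N\<close> takes part in no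
  occurrence.\<close>

lemma separable_Cons_max:
  assumes "separable xs" "\<And>x. x \<in> set xs \<Longrightarrow> x < N"
  shows "separable (N # xs)"
proof (rule separableI)
  fix zs a1 a2 a3 a4
  assume that: "subseq zs (N # xs)" "a1 < a2" "a2 < a3" "a3 < a4"
    "zs = [a2, a4, a1, a3] \<or> zs = [a3, a1, a4, a2]"
  show False
  proof -
    from that(1) have "subseq zs ([N] @ xs)" by simp
    then obtain z1 z2 where zs: "zs = z1 @ z2" and sub: "subseq z1 [N]" "subseq z2 xs"
      unfolding subseq_append_iff by blast
    from sub(1) consider "z1 = []" | "z1 = [N]"
      by (cases z1; cases "tl z1") (auto split: if_splits)
    then show False
    proof cases
      case 1
      then have "subseq zs xs" using zs sub by simp
      then show False using that(2-) by (rule separableD[OF assms(1)])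
    next
      case 2
      have "\<forall>x\<in>set z2. x < N" using assms(2) sub(2) by (auto dest: subseq_memD)
      moreover have "z2 = tl zs" "N = hd zs" using zs 2 by simp_all
      ultimately show False using that(2-) by auto
    qed
  qed
qed

text \<open>Neither pattern ends with its 4.\<close>

lemma separable_snoc_max:
  assumes "separable xs" "\<And>x. x \<in> set xs \<Longrightarrow> x < N"
  shows "separable (xs @ [N])"
proof (rule separableI)
  fix zs a1 a2 a3 a4
  assume that: "subseq zs (xs @ [N])" "a1 < a2" "a2 < a3" "a3 < a4"
    "zs = [a2, a4, a1, a3] \<or> zs = [a3, a1, a4, a2]"
  show False
  proof -
    from that(1) obtain z1 z2 where zs: "zs = z1 @ z2" and sub: "subseq z1 xs" "subseq z2 [N]"
      by (auto simp: subseq_append_iff)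
    from sub(2) consider "z2 = []" | "z2 = [N]"
      by (cases z2; cases "tl z2") (auto split: if_splits)
    then show False
    proof cases
      case 1
      then have "subseq zs xs" using zs sub by simp
      then show False using that(2-) by (rule separableD[OF assms(1)])
    next
      case 2
      have "\<forall>x\<in>set z1. x < N" using assms(2) sub(1) by (auto dest: subseq_memD)
      moreover have "z1 = butlast zs" "N = last zs" using zs 2 by simp_all
      ultimately show False using that(2-) by auto
    qed
  qed
qed

text \<open>\<open>below_bounded k A xs\<close> is the avoidance of \<open>P_k\<close> by \<open>A @ xs\<close> at the entries of \<open>xs\<close> only:
  each of them exceeds at most \<open>k - 2\<close> of the entries before it.\<close>

fun below_bounded :: "nat \<Rightarrow> nat list \<Rightarrow> nat list \<Rightarrow> bool" where
  "below_bounded k A [] \<longleftrightarrow> True"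
| "below_bounded k A (x # xs) \<longleftrightarrow>
     length (filter (\<lambda>y. y < x) A) + 1 < k \<and> below_bounded k (A @ [x]) xs"

lemma below_bounded_append:
  "below_bounded k A (xs @ ys) \<longleftrightarrow> below_bounded k A xs \<and> below_bounded k (A @ xs) ys"
  by (induction xs arbitrary: A) auto

text \<open>Trades smaller entries of the context for a smaller bound: even with truncated
  subtraction, \<open>a + 1 < k - m\<close> means \<open>a + m + 1 < k\<close>. With
  \<open>m = 0\<close> and \<open>m'\<close> the length of \<open>A\<close> it turns
  \<open>P_k\<close> behind \<open>A\<close> into \<open>P_{k - length A}\<close>.\<close>

lemma below_bounded_cong:
  assumes "\<And>x. x \<in> set xs \<Longrightarrow>
    length (filter (\<lambda>y. y < x) A) + m = length (filter (\<lambda>y. y < x) A') + m'"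
  shows "below_bounded (k - m) A xs \<longleftrightarrow> below_bounded (k - m') A' xs"
  using assms
proof (induction xs arbitrary: A A')
  case (Cons x xs)
  have "below_bounded (k - m) (A @ [x]) xs \<longleftrightarrow> below_bounded (k - m') (A' @ [x]) xs"
    by (rule Cons.IH) (use Cons.prems in auto)
  moreover have "length (filter (\<lambda>y. y < x) A) + 1 < k - m \<longleftrightarrow>
      length (filter (\<lambda>y. y < x) A') + 1 < k - m'"
    using Cons.prems[of x] unfolding less_diff_conv by simp
  ultimately show ?case by simp
qed simp

lemma below_bounded_insert_above:
  assumes "\<And>x y. x \<in> set B \<Longrightarrow> y \<in> set I \<Longrightarrow> x < y"
  shows "below_bounded k (A @ I) B \<longleftrightarrow> below_bounded k A B"
proof -
  have "length (filter (\<lambda>y. y < x) (A @ I)) + 0 = length (filter (\<lambda>y. y < x) A) + 0"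
    if "x \<in> set B" for x
  proof -
    have "filter (\<lambda>y. y < x) I = []"
      using assms that by (force simp: filter_empty_conv)
    then show ?thesis by simp
  qed
  then show ?thesis
    using below_bounded_cong[of B "A @ I" 0 A 0 k] by simp
qed

lemma below_bounded_short:
  assumes "length A + length xs < k" shows "below_bounded k A xs"
  using assms
proof (induction xs arbitrary: A)
  case (Cons x xs)
  have "length (filter (\<lambda>y. y < x) A) \<le> length A" by (rule length_filter_le)
  moreover have "below_bounded k (A @ [x]) xs" by (rule Cons.IH) (use Cons.prems in simp)
  ultimately show ?case using Cons.prems unfolding below_bounded.simps list.size by arith
qed simp

lemma below_bounded_map_add:
  "below_bounded k (map ((+) c) A) (map ((+) c) xs) \<longleftrightarrow> below_bounded k A xs"
proof (induction xs arbitrary: A)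
  case (Cons x xs)
  then show ?case using Cons.IH[of "A @ [x]"] by (simp add: filter_map o_def)
qed simp

lemma below_bounded_nth:
  "below_bounded k A xs \<longleftrightarrow> (\<forall>m < length xs. 
     length (filter (\<lambda>y. y < xs ! m) A) + card {j. j < m \<and> xs ! j < xs ! m} + 1 < k)"
proof (induction xs rule: rev_induct)
  case (snoc x xs)
  have "length (filter (\<lambda>y. y < x) xs) = card {j. j < length xs \<and> (xs @ [x]) ! j < x}"
    unfolding length_filter_conv_card by (intro arg_cong[where f = card]) (auto simp: nth_append)
  moreover have "{j. j < m \<and> (xs @ [x]) ! j < xs ! m} = {j. j < m \<and> xs ! j < xs ! m}"
    if "m < length xs" for m using that by (auto simp: nth_append)
  ultimately show ?case
    using snoc by (auto simp: below_bounded_append less_Suc_eq nth_append)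
qed simp

text \<open>An entry can end an occurrence of \<open>P_k\<close> exactly when at least
  \<open>k - 1\<close> smaller entries precede it; the order among those is free.\<close>

lemma avoids_P_iff:
  assumes "k \<ge> 1"
  shows "avoids_P k xs \<longleftrightarrow> below_bounded k [] xs"
proof
  assume av: "avoids_P k xs"
  show "below_bounded k [] xs"
  proof (rule ccontr)
    assume "\<not> below_bounded k [] xs"
    then obtain m where m: "m < length xs" "k - 1 \<le> card {j. j < m \<and> xs ! j < xs ! m}"
      by (auto simp: below_bounded_nth not_less)
    then obtain T where T: "T \<subseteq> {j. j < m \<and> xs ! j < xs ! m}" "card T = k - 1" "finite T"
      using obtain_subset_with_card_n[OF m(2)] by blast
    define l where "l = sorted_list_of_set T"
    have l: "length l = k - 1" "set l = T" "sorted_wrt (<) l"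
      using T by (auto simp: l_def)
    \<comment> \<open>The \<open>k - 1\<close> chosen positions in increasing order, then
      \<open>m\<close> for the top entry of the occurrence.\<close>
    define h where "h j = (if j = k then m else l ! (j - 1))" for j
    have hT: "h j \<in> T" if "1 \<le> j" "j < k" for j
    proof -
      have "l ! (j - 1) \<in> set l" using that l by (intro nth_mem) auto
      then show ?thesis using that l by (simp add: h_def)
    qed
    have "strict_mono_on {1..k} h"
    proof (rule strict_mono_onI)
      fix i j assume ij: "i \<in> {1..k}" "j \<in> {1..k}" "i < j"
      show "h i < h j"
      proof (cases "j = k")
        case True
        then show ?thesis using hT[of i] ij T(1) by (auto simp: h_def)
      next
        case False
        then show ?thesis using ij l by (auto simp: h_def intro!: sorted_wrt_nth_less[OF l(3)])
      qed
    qed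
    moreover have "h ` {1..k} \<subseteq> {..<length xs}"
    proof
      fix y assume "y \<in> h ` {1..k}"
      then obtain j where j: "1 \<le> j" "j \<le> k" "y = h j" by auto
      show "y \<in> {..<length xs}"
      proof (cases "j = k")
        case True
        then show ?thesis using m j by (simp add: h_def)
      next
        case False
        then have "y \<in> T" using hT j by auto
        then show ?thesis using T m by auto
      qed
    qed
    moreover have "\<forall>j\<in>{1..<k}. xs ! h j < xs ! h k"
      using hT T(1) by (fastforce simp: h_def[of k])
    ultimately show False using av unfolding avoids_P_def by blast
  qed
next
  assume bb: "below_bounded k [] xs"
  show "avoids_P k xs"
    unfolding avoids_P_def
  proof
    assume "\<exists>h :: nat \<Rightarrow> nat. strict_mono_on {1..k} h \<and> h ` {1..k} \<subseteq> {..<length xs} \<and>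
          (\<forall>j \<in> {1..<k}. xs ! h j < xs ! h k)"
    then obtain h :: "nat \<Rightarrow> nat" where h: "strict_mono_on {1..k} h" "h ` {1..k} \<subseteq> {..<length xs}"
      "\<forall>j \<in> {1..<k}. xs ! h j < xs ! h k" by blast
    have "h ` {1..<k} \<subseteq> {j. j < h k \<and> xs ! j < xs ! h k}"
      using h assms by (auto intro!: strict_mono_onD[OF h(1)])
    then have "card (h ` {1..<k}) \<le> card {j. j < h k \<and> xs ! j < xs ! h k}"
      by (intro card_mono) auto
    moreover have "card (h ` {1..<k}) = k - 1"
      using strict_mono_on_imp_inj_on[OF h(1)] by (subst card_image) (auto intro: inj_on_subset)
    moreover have "h k < length xs" using h(2) assms by (auto simp: image_subset_iff)
    ultimately show False using bb assms by (auto simp: below_bounded_nth)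
  qed
qed

text \<open>The offset \<open>c\<close> admits blocks before they are standardized. With the
  half-open interval, the upper end of one piece is the offset of the next.\<close>

definition interval_perm :: "nat \<Rightarrow> nat list \<Rightarrow> bool" where
  "interval_perm c xs \<longleftrightarrow> distinct xs \<and> set xs = {c<..c + length xs}"

lemma interval_perm_0_iff:
  "\<pi> \<in> permutations_of_set {1..n} \<longleftrightarrow> interval_perm 0 \<pi> \<and> length \<pi> = n"
proof -
  have "{1..n} = {0<..0 + n}" by auto
  then show ?thesis
    by (auto simp: interval_perm_def permutations_of_set_def dest: distinct_card)
qed

lemma interval_perm_mset:
  assumes "mset xs = mset ys"
  shows "interval_perm c xs \<longleftrightarrow> interval_perm c ys"
  using assms by (metis interval_perm_def mset_eq_imp_distinct_iff mset_eq_length mset_eq_setD)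

lemma interval_perm_map_add: "interval_perm c (map ((+) c) xs) \<longleftrightarrow> interval_perm 0 xs"
proof -
  have "{c<..c + length xs} = (+) c ` {0<..0 + length xs}"
    by simp
  then have "(+) c ` set xs = {c<..c + length xs} \<longleftrightarrow> set xs = {0<..0 + length xs}"
    by (simp only: inj_image_eq_iff[OF inj_on_add])
  then show ?thesis
    by (simp add: interval_perm_def distinct_map)
qed

lemma interval_permE:
  assumes "interval_perm c xs"
  obtains ys where "interval_perm 0 ys" "xs = map ((+) c) ys"
proof -
  have "xs = map ((+) c) (map (\<lambda>x. x - c) xs)"
    using assms by (auto simp: interval_perm_def o_def intro!: map_idI[symmetric])
  then show thesis using assms interval_perm_map_add that by metis
qed

text \<open>The values of \<open>xs\<close> are downward closed in the interval, because everything
  in \<open>ys\<close> is larger. A downward closed set of \<open>length xs\<close> values is the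
  initial segment of that size.\<close>

lemma interval_perm_append:
  assumes less: "\<And>x y. x \<in> set xs \<Longrightarrow> y \<in> set ys \<Longrightarrow> x < y"
  shows "interval_perm c (xs @ ys) \<longleftrightarrow> interval_perm c xs \<and> interval_perm (c + length xs) ys"
proof
  assume perm: "interval_perm c (xs @ ys)"
  then have un: "set xs \<union> set ys = {c<..c + length xs + length ys}"
    and dis: "distinct xs" "distinct ys" "set xs \<inter> set ys = {}"
    by (auto simp: interval_perm_def add.assoc)
  have "set xs \<subseteq> {c<..c + length xs}"
  proof
    fix x assume x: "x \<in> set xs"
    have "{c<..x} \<subseteq> set xs"
    proof
      fix z assume "z \<in> {c<..x}"
      moreover have "x \<in> set xs \<union> set ys" using x by simp
      ultimately have "z \<in> set xs \<union> set ys" unfolding un by auto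
      then show "z \<in> set xs" using less[OF x, of z] \<open>z \<in> {c<..x}\<close> by auto
    qed
    then have "x - c \<le> length xs"
      using card_mono[of "set xs" "{c<..x}"] dis by (simp add: distinct_card)
    moreover have "c < x" using un x by auto
    ultimately show "x \<in> {c<..c + length xs}" by auto
  qed
  then have xs: "set xs = {c<..c + length xs}"
    using dis by (intro card_subset_eq) (auto simp: distinct_card)
  have "set ys = {c<..c + length xs + length ys} - {c<..c + length xs}"
    using un dis xs by blast
  also have "\<dots> = {c + length xs<..c + length xs + length ys}" by auto
  finally show "interval_perm c xs \<and> interval_perm (c + length xs) ys"
    using xs dis by (simp add: interval_perm_def)
next
  assume "interval_perm c xs \<and> interval_perm (c + length xs) ys"
  then show "interval_perm c (xs @ ys)" by (auto simp: interval_perm_def)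
qed

definition separables :: "nat list set" where
  "separables = {\<pi>. interval_perm 0 \<pi> \<and> separable \<pi>}"

definition separables_P :: "nat \<Rightarrow> nat list set" where
  "separables_P k = {\<pi> \<in> separables. below_bounded k [] \<pi>}"

lemma separable_perms_eq: "separable_perms n = {\<pi>. \<pi> \<in> separables \<and> length \<pi> = n}"
  unfolding separable_perms_def separables_def separable_def interval_perm_0_iff by blast

lemma separable_P_perms_eq:
  "k \<ge> 1 \<Longrightarrow> separable_P_perms k n = {\<pi>. \<pi> \<in> separables_P k \<and> length \<pi> = n}"
  by (auto simp: separable_P_perms_def separable_perms_eq separables_P_def avoids_P_iff)

text \<open>Only the multiset of entries matters, so the pieces can be rearranged by value as
  \<open>A @ B\<close>, then \<open>I\<close>, then \<open>N\<close>, wherever they stand in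
  \<open>\<pi>\<close>. Hence one lemma serves left and right blocks.\<close>

lemma block_perm:
  assumes less: "\<And>x y. x \<in> set A \<union> set B \<Longrightarrow> y \<in> set I \<Longrightarrow> x < y"
    and N: "\<And>x. x \<in> set A \<union> set B \<union> set I \<Longrightarrow> x < N"
    and mset: "mset \<pi> = mset (A @ B) + mset I + {#N#}"
  shows "interval_perm 0 \<pi> \<longleftrightarrow> N = length A + length B + length I + 1 \<and>
    interval_perm 0 (A @ B) \<and> (\<exists>J. interval_perm 0 J \<and> I = map ((+) (length A + length B)) J)"
proof -
  have "interval_perm 0 \<pi> \<longleftrightarrow> interval_perm 0 (((A @ B) @ I) @ [N])"
    by (rule interval_perm_mset) (simp add: mset)
  also have "\<dots> \<longleftrightarrow> interval_perm 0 ((A @ B) @ I) \<and> interval_perm (length ((A @ B) @ I)) [N]"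
    using N by (subst interval_perm_append) auto
  also have "interval_perm 0 ((A @ B) @ I) \<longleftrightarrow>
      interval_perm 0 (A @ B) \<and> interval_perm (length A + length B) I"
    using less by (subst interval_perm_append) auto
  also have "interval_perm (length A + length B) I \<longleftrightarrow>
      (\<exists>J. interval_perm 0 J \<and> I = map ((+) (length A + length B)) J)"
    using interval_perm_map_add by (metis interval_permE)
  also have "interval_perm (length ((A @ B) @ I)) [N] \<longleftrightarrow> N = length A + length B + length I + 1"
    by (auto simp: interval_perm_def)
  finally show ?thesis by blast
qed

lemma max_perm:
  assumes "\<And>x. x \<in> set A \<union> set B \<Longrightarrow> x < N"
  shows "interval_perm 0 (A @ N # B) \<longleftrightarrow> N = length A + length B + 1 \<and> interval_perm 0 (A @ B)"
  using block_perm[of A B "[]" N "A @ N # B"] assms by (auto simp: interval_perm_def)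

lemma interval_perm_0_le: "interval_perm 0 xs \<Longrightarrow> x \<in> set xs \<Longrightarrow> x \<le> length xs"
  by (auto simp: interval_perm_def)

lemma interval_perm_max_less:
  assumes "interval_perm 0 (A @ (length A + length B + 1) # B)" "x \<in> set A \<union> set B"
  shows "x < length A + length B + 1"
proof -
  have "x \<le> length A + length B + 1" using interval_perm_0_le[OF assms(1), of x] assms(2) by auto
  moreover have "x \<noteq> length A + length B + 1" using assms by (auto simp: interval_perm_def)
  ultimately show ?thesis by simp
qed

text \<open>All of \<open>A\<close> counts at \<open>N\<close>, and this already leaves the entries
  of \<open>A\<close> too few predecessors to violate their own bounds. Behind \<open>N\<close>, the
  maximum is never among the smaller entries.\<close>

lemma max_bounded:
  assumes "\<And>x. x \<in> set A \<union> set B \<Longrightarrow> x < N"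
  shows "below_bounded k [] (A @ N # B) \<longleftrightarrow> length A + 1 < k \<and> below_bounded k A B"
proof -
  have "filter (\<lambda>y. y < N) A = A" using assms by (auto simp: filter_id_conv)
  moreover have "below_bounded k (A @ [N]) B \<longleftrightarrow> below_bounded k A B"
    using assms by (intro below_bounded_insert_above) auto
  moreover have "length A + 1 < k \<Longrightarrow> below_bounded k [] A" by (rule below_bounded_short) simp
  ultimately show ?thesis by (auto simp: below_bounded_append)
qed

text \<open>\<open>N # I\<close> is an inflation of the maximum of the reduced permutation. Each
  block entry exceeds the whole of \<open>A\<close>, which lowers its bound from \<open>k\<close> to
  \<open>k - length A\<close>; the entries of \<open>B\<close> exceed nothing in the block.\<close>

lemma right_block_iff:
  assumes less: "\<And>x y. x \<in> set A \<union> set B \<Longrightarrow> y \<in> set I \<Longrightarrow> x < y"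
    and N: "\<And>x. x \<in> set A \<union> set B \<union> set I \<Longrightarrow> x < N"
  shows "A @ N # I @ B \<in> separables_P k \<longleftrightarrow> N = length A + length B + length I + 1 \<and>
    A @ (length A + length B + 1) # B \<in> separables_P k \<and>
    (\<exists>J \<in> separables_P (k - length A). I = map ((+) (length A + length B)) J)"
proof -
  let ?c = "length A + length B"
  let ?\<sigma> = "A @ (?c + 1) # B"
  have perm: "interval_perm 0 (A @ N # I @ B) \<longleftrightarrow> N = ?c + length I + 1 \<and>
    interval_perm 0 (A @ B) \<and> (\<exists>J. interval_perm 0 J \<and> I = map ((+) ?c) J)"
    by (rule block_perm[OF less N]) auto
  have bnd: "below_bounded k [] (A @ N # I @ B) \<longleftrightarrow>
      length A + 1 < k \<and> below_bounded (k - length A) [] I \<and> below_bounded k A B"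
  proof -
    have "below_bounded k [] (A @ N # I @ B) \<longleftrightarrow> length A + 1 < k \<and> below_bounded k A (I @ B)"
      using N by (intro max_bounded) auto
    moreover have "below_bounded k A I \<longleftrightarrow> below_bounded (k - length A) [] I"
    proof -
      have "length (filter (\<lambda>y. y < x) A) + 0 = length (filter (\<lambda>y. y < x) []) + length A"
        if "x \<in> set I" for x
      proof -
        have "filter (\<lambda>y. y < x) A = A" using less that by (auto simp: filter_id_conv)
        then show ?thesis by simp
      qed
      then show ?thesis
        using below_bounded_cong[of I A 0 "[]" "length A" k] by simp
    qed
    moreover have "below_bounded k (A @ I) B \<longleftrightarrow> below_bounded k A B"
      using less by (intro below_bounded_insert_above) auto
    ultimately show ?thesis by (auto simp: below_bounded_append)
  qed
  show ?thesis
  \<comment> \<open>Replacing the block by \<open>length A + length B + 1\<close> needs this value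
    to lie above \<open>A\<close> and \<open>B\<close>, which is known when \<open>A @ B\<close> is
    a permutation. Otherwise both sides are false.\<close>
  proof (cases "interval_perm 0 (A @ B)")
    case True
    then have c: "x < ?c + 1" if "x \<in> set A \<union> set B" for x
      using interval_perm_0_le[of "A @ B" x] that by auto
    have sep: "separable (A @ N # I @ B) \<longleftrightarrow> separable ?\<sigma> \<and> separable I"
    proof
      assume *: "separable (A @ N # I @ B)"
      then have "separable (A @ (N # I) @ B)" by simp
      then have "separable ?\<sigma>"
        by (rule separable_deflate) (use less N c in auto)
      moreover have "subseq ([] @ I @ []) (A @ (N # I) @ B)"
        by (intro list_emb_append_mono) auto
      then have "separable I" using separable_subseq[OF *] by simp
      ultimately show "separable ?\<sigma> \<and> separable I" ..
    next
      assume "separable ?\<sigma> \<and> separable I"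
      then have "separable (A @ (N # I) @ B)"
        using less N c by (intro separable_inflate[of A B "N # I" "?c + 1"] separable_Cons_max) auto
      then show "separable (A @ N # I @ B)" by simp
    qed
    have "interval_perm 0 ?\<sigma>" using True max_perm[OF c] by blast
    moreover have "below_bounded k [] ?\<sigma> \<longleftrightarrow> length A + 1 < k \<and> below_bounded k A B"
      by (rule max_bounded[OF c])
    moreover have "below_bounded (k - length A) [] (map ((+) ?c) J) \<longleftrightarrow>
        below_bounded (k - length A) [] J" for J
      using below_bounded_map_add[of _ ?c "[]"] by simp
    ultimately show ?thesis
      using True by (auto simp: separables_P_def separables_def perm bnd sep separable_map_add)
  next
    case False
    have "?\<sigma> \<notin> separables_P k"
    proof
      assume "?\<sigma> \<in> separables_P k"
      then have "interval_perm 0 ?\<sigma>" by (simp add: separables_P_def separables_def)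
      from max_perm[OF interval_perm_max_less[OF this]] this False show False by blast
    qed
    then show ?thesis using False by (auto simp: separables_P_def separables_def perm)
  qed
qed

text \<open>Here \<open>I @ [N]\<close> inflates the maximum. The block now precedes
  \<open>N\<close>, so its length enters the bound at \<open>N\<close>, and that bound implies those
  of all the block entries.\<close>

lemma left_block_iff:
  assumes less: "\<And>x y. x \<in> set A \<union> set B \<Longrightarrow> y \<in> set I \<Longrightarrow> x < y"
    and N: "\<And>x. x \<in> set A \<union> set B \<union> set I \<Longrightarrow> x < N"
  shows "A @ I @ N # B \<in> separables_P k \<longleftrightarrow> N = length A + length B + length I + 1 \<and>
    A @ (length A + length B + 1) # B \<in> separables_P k \<and> length A + length I + 1 < k \<and>
    (\<exists>J \<in> separables. I = map ((+) (length A + length B)) J)"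
proof -
  let ?c = "length A + length B"
  let ?\<sigma> = "A @ (?c + 1) # B"
  have perm: "interval_perm 0 (A @ I @ N # B) \<longleftrightarrow> N = ?c + length I + 1 \<and>
    interval_perm 0 (A @ B) \<and> (\<exists>J. interval_perm 0 J \<and> I = map ((+) ?c) J)"
    by (rule block_perm[OF less N]) auto
  have bnd: "below_bounded k [] (A @ I @ N # B) \<longleftrightarrow>
      length A + length I + 1 < k \<and> below_bounded k A B"
  proof -
    have "below_bounded k [] ((A @ I) @ N # B) \<longleftrightarrow>
        length (A @ I) + 1 < k \<and> below_bounded k (A @ I) B"
      using N by (intro max_bounded) auto
    moreover have "below_bounded k (A @ I) B \<longleftrightarrow> below_bounded k A B"
      using less by (intro below_bounded_insert_above) auto
    ultimately show ?thesis by auto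
  qed
  show ?thesis
  proof (cases "interval_perm 0 (A @ B)")
    case True
    then have c: "x < ?c + 1" if "x \<in> set A \<union> set B" for x
      using interval_perm_0_le[of "A @ B" x] that by auto
    have sep: "separable (A @ I @ N # B) \<longleftrightarrow> separable ?\<sigma> \<and> separable I"
    proof
      assume *: "separable (A @ I @ N # B)"
      then have "separable (A @ (I @ [N]) @ B)" by simp
      then have "separable ?\<sigma>"
        by (rule separable_deflate) (use less N c in auto)
      moreover have "subseq ([] @ I @ []) (A @ I @ N # B)"
        by (intro list_emb_append_mono) auto
      then have "separable I" using separable_subseq[OF *] by simp
      ultimately show "separable ?\<sigma> \<and> separable I" ..
    next
      assume "separable ?\<sigma> \<and> separable I"
      then have "separable (A @ (I @ [N]) @ B)"
        using less N c by (intro separable_inflate[of A B "I @ [N]" "?c + 1"] separable_snoc_max) auto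
      then show "separable (A @ I @ N # B)" by simp
    qed
    have "interval_perm 0 ?\<sigma>" using True max_perm[OF c] by blast
    moreover have "below_bounded k [] ?\<sigma> \<longleftrightarrow> length A + 1 < k \<and> below_bounded k A B"
      by (rule max_bounded[OF c])
    ultimately show ?thesis
      using True by (auto simp: separables_P_def separables_def perm bnd sep separable_map_add)
  next
    case False
    have "?\<sigma> \<notin> separables_P k"
    proof
      assume "?\<sigma> \<in> separables_P k"
      then have "interval_perm 0 ?\<sigma>" by (simp add: separables_P_def separables_def)
      from max_perm[OF interval_perm_max_less[OF this]] this False show False by blast
    qed
    then show ?thesis using False by (auto simp: separables_P_def separables_def perm)
  qed
qed

section \<open>Removing a block next to the maximum\<close>

text \<open>The condition \<open>P\<close> sees only the sets of values on the two sides of the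
  maximum. The length of \<open>A\<close> makes the split unique, so \<open>P\<close> is a property
  of the permutation.\<close>

definition max_at :: "nat \<Rightarrow> nat \<Rightarrow> (nat set \<Rightarrow> nat set \<Rightarrow> bool) \<Rightarrow> nat list set" where
  "max_at k i P = {\<pi> \<in> separables_P k. \<exists>A N R. \<pi> = A @ N # R \<and> length A = i \<and>
     (\<forall>x\<in>set A \<union> set R. x < N) \<and> P (set A) (set R)}"

lemma max_at_iff:
  assumes "length A = i"
  shows "A @ N # R \<in> max_at k i P \<longleftrightarrow>
    A @ N # R \<in> separables_P k \<and> (\<forall>x\<in>set A \<union> set R. x < N) \<and> P (set A) (set R)"
  using assms by (auto simp: max_at_def)

lemma separables_P_perm: "\<pi> \<in> separables_P k \<Longrightarrow> interval_perm 0 \<pi>"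
  by (simp add: separables_P_def separables_def)

lemma max_atE:
  assumes "\<pi> \<in> max_at k i P"
  obtains A R where "\<pi> = A @ (length A + length R + 1) # R" "length A = i" "P (set A) (set R)"
    "\<pi> \<in> separables_P k" "\<forall>x\<in>set A \<union> set R. x < length A + length R + 1"
    "interval_perm 0 (A @ R)"
proof -
  from assms obtain A N R where *: "\<pi> = A @ N # R" "length A = i"
    "\<forall>x\<in>set A \<union> set R. x < N" "P (set A) (set R)" "\<pi> \<in> separables_P k"
    by (auto simp: max_at_def)
  moreover have "N = length A + length R + 1 \<and> interval_perm 0 (A @ R)"
    using max_perm[of A R N] * separables_P_perm[of \<pi> k] by auto
  ultimately show thesis by (intro that[of A R]) auto
qed

lemma right_split:
  assumes \<pi>: "A @ N # R \<in> separables_P k" and N: "\<forall>x\<in>set A \<union> set R. x < N"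
    and y: "\<exists>y\<in>set R. \<forall>x\<in>set A. x < y"
  obtains I B where "R = I @ B" "I \<noteq> []" "below A I" "below B I" "\<forall>y\<in>set B. \<exists>x\<in>set A. y < x"
proof -
  have sep: "separable (A @ N # R)" and "interval_perm 0 (A @ N # R)"
    using \<pi> by (simp_all add: separables_P_def separables_def)
  then have dist: "set A \<inter> set R = {}" by (auto simp: interval_perm_def)
  define P where "P y \<longleftrightarrow> (\<forall>x\<in>set A. x < y)" for y
  define I where "I = takeWhile P R"
  define B where "B = dropWhile P R"
  have R: "R = I @ B" by (simp add: I_def B_def)
  have I: "\<forall>y\<in>set I. P y" using set_takeWhileD unfolding I_def by fast
  have B: "\<exists>x\<in>set A. y < x" if "y \<in> set B" for y
  proof -
    have "B \<noteq> []" using that by auto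
    then obtain b B' where B': "B = b # B'" by (auto simp: neq_Nil_conv)
    then have "\<not> P b" using hd_dropWhile[of P R] unfolding B_def by auto
    then obtain a where a: "a \<in> set A" "\<not> a < b" by (auto simp: P_def)
    moreover have "a \<noteq> b" using dist a R B' by auto
    ultimately have ab: "b < a" by simp
    \<comment> \<open>If \<open>y\<close> exceeded all of \<open>A\<close>, then
      \<open>a, N, b, y\<close> with \<open>b < a < y < N\<close> would be an occurrence of
      2413.\<close>
    have "\<not> P y"
    proof
      assume "P y"
      then have "a < y" "y \<noteq> b" using a ab by (auto simp: P_def)
      then have "y \<in> set B'" using that B' by simp
      then have "subseq ([a] @ [N] @ [] @ [b] @ [y]) (A @ [N] @ I @ [b] @ B')"
        using a by (intro list_emb_append_mono) (auto simp: subseq_singleton_left)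
      then have "subseq [a, N, b, y] (A @ N # R)" by (simp add: R B')
      moreover have "y < N" using N R that by simp
      ultimately show False using ab \<open>a < y\<close> by (intro separableD[OF sep]) auto
    qed
    then obtain x where x: "x \<in> set A" "\<not> x < y" by (auto simp: P_def)
    moreover have "x \<noteq> y" using dist x that R by auto
    ultimately show ?thesis by (auto intro!: bexI[of _ x])
  qed
  have "I \<noteq> []"
  proof
    assume "I = []"
    then have "\<exists>y\<in>set B. P y" using y R by (auto simp: P_def)
    then show False using B by (fastforce simp: P_def)
  qed
  moreover have "below A I" using I by (auto simp: below_def P_def)
  moreover have "below B I"
    using B I unfolding below_def P_def by (blast intro: less_trans)
  ultimately show thesis using that R B by blast
qed

lemma left_split:
  assumes \<pi>: "L @ N # B \<in> separables_P k" and N: "\<forall>x\<in>set L \<union> set B. x < N"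
    and x: "\<exists>x\<in>set L. \<forall>y\<in>set B. y < x"
  obtains A I where "L = A @ I" "I \<noteq> []" "below A I" "below B I" "\<forall>x\<in>set A. \<exists>y\<in>set B. x < y"
proof -
  have sep: "separable (L @ N # B)" and "interval_perm 0 (L @ N # B)"
    using \<pi> by (simp_all add: separables_P_def separables_def)
  then have dist: "set L \<inter> set B = {}" by (auto simp: interval_perm_def)
  \<comment> \<open>The block stands at the end of \<open>L\<close>, so the predicate describes the
    prefix before it: entries exceeded by something in \<open>B\<close>.\<close>
  define P where "P x \<longleftrightarrow> (\<exists>y\<in>set B. x < y)" for x
  define A where "A = takeWhile P L"
  define I where "I = dropWhile P L"
  have L: "L = A @ I" by (simp add: I_def A_def)
  have A: "\<forall>x\<in>set A. P x" using set_takeWhileD unfolding A_def by fast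
  have I: "b < x" if "x \<in> set I" "b \<in> set B" for x b
  proof -
    have "I \<noteq> []" using that by auto
    then obtain c I' where I': "I = c # I'" by (auto simp: neq_Nil_conv)
    then have "\<not> P c" using hd_dropWhile[of P L] unfolding I_def by auto
    \<comment> \<open>Otherwise \<open>c, x, N, y\<close> with \<open>x < y < c < N\<close> would be
      an occurrence of 3142.\<close>
    have "\<not> P x"
    proof
      assume "P x"
      then obtain y where y: "y \<in> set B" "x < y" by (auto simp: P_def)
      have "\<not> c < y" using \<open>\<not> P c\<close> y by (auto simp: P_def)
      moreover have "c \<noteq> y" using dist y L I' by auto
      ultimately have "y < c" by simp
      have "x \<in> set I'" using that I' \<open>P x\<close> \<open>\<not> P c\<close> by auto
      then have "subseq ([] @ [c] @ [x] @ [N] @ [y]) (A @ [c] @ I' @ [N] @ B)"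
        using y by (intro list_emb_append_mono) (auto simp: subseq_singleton_left)
      then have "subseq [c, x, N, y] (L @ N # B)" by (simp add: L I')
      moreover have "c < N" using N L I' by simp
      ultimately show False using y \<open>y < c\<close> by (intro separableD[OF sep]) auto
    qed
    then have "\<not> x < b" using that by (auto simp: P_def)
    moreover have "x \<noteq> b" using dist that L by auto
    ultimately show ?thesis by simp
  qed
  have "I \<noteq> []"
  proof
    assume "I = []"
    then obtain x where "P x" "\<forall>y\<in>set B. y < x" using x L A by auto
    then show False by (fastforce simp: P_def)
  qed
  moreover have "below B I" using I by (auto simp: below_def)
  moreover have "below A I"
    using A I unfolding below_def P_def by (blast intro: less_trans)
  ultimately show thesis using that L A unfolding P_def by blast
qed

lemma append_split_unique:
  assumes "xs @ ys = xs' @ ys'" "\<forall>x\<in>set xs. P x" "\<forall>x\<in>set xs'. P x"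
    "\<forall>x\<in>set ys. \<not> P x" "\<forall>x\<in>set ys'. \<not> P x"
  shows "xs = xs' \<and> ys = ys'"
proof -
  have "takeWhile P (xs @ ys) = xs" "takeWhile P (xs' @ ys') = xs'"
    using assms(2-) by (cases ys; cases ys'; simp add: takeWhile_append)+
  then show ?thesis using assms(1) by auto
qed

text \<open>The maximum at position \<open>i\<close> is dropped and \<open>\<rho>\<close> is shifted
  past the other \<open>length \<sigma> - 1\<close> values. The new maximum is the length of the
  result.\<close>

definition insert_right :: "nat \<Rightarrow> nat list \<Rightarrow> nat list \<Rightarrow> nat list" where
  "insert_right i \<sigma> \<rho> = take i \<sigma> @ (length \<sigma> + length \<rho>) # map ((+) (length \<sigma> - 1)) \<rho> @ drop (Suc i) \<sigma>"

definition insert_left :: "nat \<Rightarrow> nat list \<Rightarrow> nat list \<Rightarrow> nat list" where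
  "insert_left i \<rho> \<sigma> = take i \<sigma> @ map ((+) (length \<sigma> - 1)) \<rho> @ (length \<sigma> + length \<rho>) # drop (Suc i) \<sigma>"

lemma insert_right_eq:
  "length A = i \<Longrightarrow> insert_right i (A @ m # B) \<rho> =
    A @ (length A + length B + length \<rho> + 1) # map ((+) (length A + length B)) \<rho> @ B"
  by (simp add: insert_right_def)

lemma insert_left_eq:
  "length A = i \<Longrightarrow> insert_left i \<rho> (A @ m # B) =
    A @ map ((+) (length A + length B)) \<rho> @ (length A + length B + length \<rho> + 1) # B"
  by (simp add: insert_left_def)

lemma shifted_block:
  assumes "interval_perm 0 \<rho>" "interval_perm 0 xs" "length xs = c"
  shows "below xs (map ((+) c) \<rho>)" "\<forall>x\<in>set xs. x < c + length \<rho> + 1"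
    "\<forall>y\<in>set (map ((+) c) \<rho>). y < c + length \<rho> + 1"
  using assms by (auto simp: below_def interval_perm_def)

text \<open>Says that the second largest value is on the right without naming it. For empty
  \<open>X\<close> it asks for nonempty \<open>Y\<close>, which leaves out the one-entry permutation
  that \<open>f_gf k 0\<close> also counts.\<close>

definition top_right :: "nat set \<Rightarrow> nat set \<Rightarrow> bool" where
  "top_right X Y \<longleftrightarrow> (\<exists>y\<in>Y. \<forall>x\<in>X. x < y)"

definition top_left :: "nat set \<Rightarrow> nat set \<Rightarrow> bool" where
  "top_left X Y \<longleftrightarrow> (\<exists>x\<in>X. \<forall>y\<in>Y. y < x)"

text \<open>The flag \<open>b\<close> separates the block that ends the permutation, whose weight needs a different
  factor, from the one that does not.\<close>

lemma bij_insert_right: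
  assumes "1 \<le> i"
  shows "bij_betw (\<lambda>(\<sigma>, \<rho>). insert_right i \<sigma> \<rho>)
    (max_at k i (\<lambda>X Y. top_left X Y \<and> (Y = {} \<longleftrightarrow> b)) \<times> (separables_P (k - i) - {[]}))
    (max_at k i (\<lambda>X Y. top_right X Y \<and> ((\<forall>x\<in>X. \<forall>y\<in>Y. x < y) \<longleftrightarrow> b)))"
    (is "bij_betw ?h (?S \<times> ?T) ?U")
proof (rule bij_betwI', goal_cases)
  case (1 z z')
  obtain \<sigma> \<rho> \<sigma>' \<rho>' where z: "z = (\<sigma>, \<rho>)" "z' = (\<sigma>', \<rho>')" by (metis surj_pair)
  with 1 have \<rho>: "interval_perm 0 \<rho>" "interval_perm 0 \<rho>'" by (auto dest: separables_P_perm)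
  from 1 z have "\<sigma> \<in> ?S" "\<sigma>' \<in> ?S" by auto
  from max_atE[OF this(1)] obtain A B where \<sigma>: "\<sigma> = A @ (length A + length B + 1) # B" "length A = i"
      "top_left (set A) (set B) \<and> (set B = {} \<longleftrightarrow> b)" "\<sigma> \<in> separables_P k"
      "\<forall>x\<in>set A \<union> set B. x < length A + length B + 1" "interval_perm 0 (A @ B)" .
  from max_atE[OF \<open>\<sigma>' \<in> ?S\<close>] obtain A' B' where
      \<sigma>': "\<sigma>' = A' @ (length A' + length B' + 1) # B'" "length A' = i"
      "top_left (set A') (set B') \<and> (set B' = {} \<longleftrightarrow> b)" "\<sigma>' \<in> separables_P k"
      "\<forall>x\<in>set A' \<union> set B'. x < length A' + length B' + 1" "interval_perm 0 (A' @ B')" .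
  show ?case
  proof
    assume "?h z = ?h z'"
    then have eq: "insert_right i \<sigma> \<rho> = insert_right i \<sigma>' \<rho>'" by (simp add: z)
    let ?I = "map ((+) (length A + length B)) \<rho>" and ?I' = "map ((+) (length A' + length B')) \<rho>'"
    let ?N = "length A + length B + length \<rho> + 1" and ?N' = "length A' + length B' + length \<rho>' + 1"
    have "A @ ?N # ?I @ B = A' @ ?N' # ?I' @ B'"
      using eq by (simp only: \<sigma>(1) \<sigma>'(1) insert_right_eq[OF \<sigma>(2)] insert_right_eq[OF \<sigma>'(2)])
    then have "A = A' \<and> ?N # ?I @ B = ?N' # ?I' @ B'"
      using \<sigma>(2) \<sigma>'(2) by (subst (asm) append_eq_append_conv) simp_all
    then have A: "A = A'" "?I @ B = ?I' @ B'" unfolding list.inject by blast+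
    have "?I = ?I' \<and> B = B'"
    \<comment> \<open>The lengths of the blocks are not known to agree, so the cut is recovered from
      values: block entries exceed all of \<open>A\<close>, and by \<open>top_left\<close> no entry
      of \<open>B\<close> does.\<close>
    proof (rule append_split_unique[OF A(2), of "\<lambda>y. \<forall>x\<in>set A. x < y"])
      show "\<forall>y\<in>set ?I. \<forall>x\<in>set A. x < y" "\<forall>y\<in>set ?I'. \<forall>x\<in>set A. x < y"
        using shifted_block(1)[OF \<rho>(1) \<sigma>(6) length_append] A(1)
          shifted_block(1)[OF \<rho>(2) \<sigma>'(6) length_append]
        by (auto simp: below_def)
      show "\<forall>y\<in>set B. \<not> (\<forall>x\<in>set A. x < y)" "\<forall>y\<in>set B'. \<not> (\<forall>x\<in>set A. x < y)"
        using \<sigma>(3) \<sigma>'(3) A(1) unfolding top_left_def by (blast dest: less_asym)+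
    qed
    then have "B = B'" "?I = map ((+) (length A + length B)) \<rho>'" using A(1) by auto
    then have "\<rho> = \<rho>'" by (auto simp: inj_map_eq_map)
    then show "z = z'" using \<open>B = B'\<close> A(1) by (simp add: z \<sigma>(1) \<sigma>'(1))
  qed simp
next
  case (2 z)
  then obtain \<sigma> \<rho> where z: "z = (\<sigma>, \<rho>)" "\<sigma> \<in> ?S" "\<rho> \<in> separables_P (k - i)" "\<rho> \<noteq> []" by auto
  from max_atE[OF z(2)] obtain A B where \<sigma>: "\<sigma> = A @ (length A + length B + 1) # B" "length A = i"
      "top_left (set A) (set B) \<and> (set B = {} \<longleftrightarrow> b)" "\<sigma> \<in> separables_P k"
      "\<forall>x\<in>set A \<union> set B. x < length A + length B + 1" "interval_perm 0 (A @ B)" .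
  let ?I = "map ((+) (length A + length B)) \<rho>" and ?N = "length A + length B + length \<rho> + 1"
  note sb = shifted_block[OF separables_P_perm[OF z(3)] \<sigma>(6) length_append]
  have "A @ ?N # ?I @ B \<in> separables_P k"
    using z(3) \<sigma> sb by (subst right_block_iff) (auto simp: below_def)
  moreover have "?I \<noteq> []" using z by simp
  then have "top_right (set A) (set (?I @ B))"
    using sb(1) unfolding top_right_def below_def by (cases ?I) auto
  moreover have "(\<forall>x\<in>set A. \<forall>y\<in>set (?I @ B). x < y) \<longleftrightarrow> b"
  proof (cases b)
    case True
    then show ?thesis using \<sigma>(3) sb(1) by (auto simp: below_def)
  next
    case False
    then obtain y where "y \<in> set B" using \<sigma>(3) by (metis ex_in_conv)
    moreover from this obtain x where "x \<in> set A" "y < x" using \<sigma>(3) by (auto simp: top_left_def)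
    moreover have "y \<in> set (?I @ B)" "\<not> x < y" using \<open>y \<in> set B\<close> \<open>y < x\<close> by simp_all
    ultimately show ?thesis using False by blast
  qed
  moreover have "\<forall>x\<in>set A \<union> set (?I @ B). x < ?N" using sb by auto
  ultimately have "A @ ?N # ?I @ B \<in> ?U" using \<sigma>(2) by (subst max_at_iff) auto
  then show ?case using \<sigma>(1,2) by (simp add: z insert_right_eq)
next
  case (3 \<pi>)
  from max_atE[OF 3] obtain A R where \<pi>: "\<pi> = A @ (length A + length R + 1) # R" "length A = i"
      "top_right (set A) (set R) \<and> ((\<forall>x\<in>set A. \<forall>y\<in>set R. x < y) \<longleftrightarrow> b)" "\<pi> \<in> separables_P k"
      "\<forall>x\<in>set A \<union> set R. x < length A + length R + 1" "interval_perm 0 (A @ R)" .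
  from right_split[OF \<pi>(4)[unfolded \<pi>(1)] \<pi>(5) \<pi>(3)[THEN conjunct1, unfolded top_right_def]]
  obtain I B where R: "R = I @ B" "I \<noteq> []" "below A I" "below B I"
      "\<forall>y\<in>set B. \<exists>x\<in>set A. y < x" .
  let ?\<sigma> = "A @ (length A + length B + 1) # B"
  have *: "A @ (length A + length R + 1) # I @ B \<in> separables_P k"
    using \<pi>(4) unfolding \<pi>(1) R(1) .
  have "length A + length R + 1 = length A + length B + length I + 1 \<and> ?\<sigma> \<in> separables_P k \<and>
      (\<exists>J\<in>separables_P (k - length A). I = map ((+) (length A + length B)) J)"
    by (rule right_block_iff[THEN iffD1, OF _ _ *]) (use R \<pi>(5) in \<open>auto simp: below_def\<close>)
  then obtain J where J: "J \<in> separables_P (k - length A)" "I = map ((+) (length A + length B)) J"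
    and \<sigma>: "?\<sigma> \<in> separables_P k"
    by blast
  have "x < length A + length B + 1" if "x \<in> set A \<union> set B" for x
    using separables_P_perm[OF \<sigma>] that by (rule interval_perm_max_less)
  \<comment> \<open>Every entry of \<open>B\<close> is below some entry of \<open>A\<close>, so the
    largest entry of \<open>A\<close>, which exists because \<open>1 \<le> i\<close>, is above all
    of \<open>B\<close>. This is why removing a right block leads from \<open>f_gf\<close> to
    \<open>g_gf\<close>.\<close>
  moreover have "top_left (set A) (set B)"
  proof -
    have "set A \<noteq> {}" using \<pi>(2) assms by auto
    then have "Max (set A) \<in> set A" by simp
    moreover have "y < Max (set A)" if y: "y \<in> set B" for y
    proof -
      obtain x where "x \<in> set A" "y < x" using R(5) y by blast
      then show ?thesis by (metis List.finite_set Max_ge less_le_trans)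
    qed
    ultimately show ?thesis unfolding top_left_def by blast
  qed
  moreover have "set B = {} \<longleftrightarrow> b"
  proof -
    have "(\<forall>x\<in>set A. \<forall>y\<in>set R. x < y) \<longleftrightarrow> set B = {}"
    proof
      assume all: "\<forall>x\<in>set A. \<forall>y\<in>set R. x < y"
      show "set B = {}"
      proof (rule equals0I)
        fix y assume y: "y \<in> set B"
        then obtain x where "x \<in> set A" "y < x" using R(5) by blast
        moreover have "x < y" using all y \<open>x \<in> set A\<close> R(1) by simp
        ultimately show False by simp
      qed
    next
      assume "set B = {}"
      then show "\<forall>x\<in>set A. \<forall>y\<in>set R. x < y" using R(1,3) by (simp add: below_def)
    qed
    then show ?thesis using \<pi>(3) by simp
  qed
  ultimately have "?\<sigma> \<in> ?S" using \<sigma> \<pi>(2) by (subst max_at_iff) auto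
  moreover have "J \<in> ?T" using J \<pi>(2) R(2) by auto
  moreover have "\<pi> = ?h (?\<sigma>, J)" using \<pi>(1,2) R(1) J(2) by (simp add: insert_right_eq)
  ultimately show ?case by blast
qed

text \<open>The block length \<open>j\<close> can be read off the result as the number of left
  values above the whole right side. With nothing on the right, that count would be all of the left
  side, hence \<open>Y \<noteq> {}\<close>. Since \<open>j\<close> is fixed, positions alone
  determine the cut.\<close>

lemma bij_insert_left:
  assumes "1 \<le> j" "j \<le> i" "i + 1 < k"
  shows "bij_betw (\<lambda>(\<rho>, \<sigma>). insert_left (i - j) \<rho> \<sigma>)
    ({\<rho> \<in> separables. length \<rho> = j} \<times> max_at k (i - j) top_right)
    (max_at k i (\<lambda>X Y. Y \<noteq> {} \<and> card {x \<in> X. \<forall>y\<in>Y. y < x} = j))"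
    (is "bij_betw ?h (?T \<times> ?S) ?U")
proof (rule bij_betwI', goal_cases)
  case (1 z z')
  obtain \<sigma> \<rho> \<sigma>' \<rho>' where z: "z = (\<rho>, \<sigma>)" "z' = (\<rho>', \<sigma>')" by (metis surj_pair)
  with 1 have \<rho>: "length \<rho> = j" "length \<rho>' = j" by auto
  from 1 z have "\<sigma> \<in> ?S" "\<sigma>' \<in> ?S" by auto
  from max_atE[OF this(1)] obtain A B where
      \<sigma>: "\<sigma> = A @ (length A + length B + 1) # B" "length A = i - j" .
  from max_atE[OF \<open>\<sigma>' \<in> ?S\<close>] obtain A' B' where
      \<sigma>': "\<sigma>' = A' @ (length A' + length B' + 1) # B'" "length A' = i - j" .
  show ?case
  proof
    assume "?h z = ?h z'"
    then have eq: "insert_left (i - j) \<rho> \<sigma> = insert_left (i - j) \<rho>' \<sigma>'" by (simp add: z)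
    let ?I = "map ((+) (length A + length B)) \<rho>" and ?I' = "map ((+) (length A' + length B')) \<rho>'"
    let ?N = "length A + length B + length \<rho> + 1" and ?N' = "length A' + length B' + length \<rho>' + 1"
    have "A @ ?I @ ?N # B = A' @ ?I' @ ?N' # B'"
      using eq by (simp only: \<sigma>(1) \<sigma>'(1) insert_left_eq[OF \<sigma>(2)] insert_left_eq[OF \<sigma>'(2)])
    then have "A = A' \<and> ?I @ ?N # B = ?I' @ ?N' # B'"
      using \<sigma>(2) \<sigma>'(2) by (subst (asm) append_eq_append_conv) simp_all
    moreover have "length ?I = length ?I'" by (simp add: \<rho>)
    ultimately have "A = A'" "?I = ?I'" "B = B'"
      using append_eq_append_conv[of ?I ?I' "?N # B" "?N' # B'"] unfolding list.inject by blast+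
    then have "\<rho> = \<rho>'" by (simp add: inj_map_eq_map)
    then show "z = z'" using \<open>B = B'\<close> \<open>A = A'\<close> by (simp add: z \<sigma>(1) \<sigma>'(1))
  qed simp
next
  case (2 z)
  then obtain \<sigma> \<rho> where z: "z = (\<rho>, \<sigma>)" "\<sigma> \<in> ?S" "\<rho> \<in> separables" "length \<rho> = j" by auto
  from max_atE[OF z(2)] obtain A B where \<sigma>: "\<sigma> = A @ (length A + length B + 1) # B" "length A = i - j"
      "top_right (set A) (set B)" "\<sigma> \<in> separables_P k"
      "\<forall>x\<in>set A \<union> set B. x < length A + length B + 1" "interval_perm 0 (A @ B)" .
  have \<rho>: "interval_perm 0 \<rho>" using z by (simp add: separables_def)
  let ?I = "map ((+) (length A + length B)) \<rho>" and ?N = "length A + length B + length \<rho> + 1"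
  note sb = shifted_block[OF \<rho> \<sigma>(6) length_append]
  have "A @ ?I @ ?N # B \<in> separables_P k"
    using z(3,4) \<sigma> sb assms by (subst left_block_iff) (auto simp: below_def)
  moreover have "set B \<noteq> {}" using \<sigma>(3) by (auto simp: top_right_def)
  moreover have "{x \<in> set (A @ ?I). \<forall>y\<in>set B. y < x} = set ?I"
  proof -
    have "\<not> (\<forall>y\<in>set B. y < x)" if "x \<in> set A" for x
      using \<sigma>(3) that unfolding top_right_def by (blast dest: less_asym)
    moreover have "\<forall>y\<in>set B. y < x" if "x \<in> set ?I" for x
      using sb(1) that unfolding below_def by auto
    ultimately show ?thesis unfolding set_append by blast
  qed
  moreover have "card (set ?I) = j"
    using \<rho> z(4) by (subst distinct_card) (auto simp: interval_perm_def distinct_map)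
  moreover have "\<forall>x\<in>set (A @ ?I) \<union> set B. x < ?N" using sb by auto
  ultimately have "(A @ ?I) @ ?N # B \<in> ?U" using \<sigma>(2) z(4) assms by (subst max_at_iff) auto
  then show ?case using \<sigma>(1,2) by (simp add: z insert_left_eq)
next
  case (3 \<pi>)
  from max_atE[OF 3] obtain L B where \<pi>: "\<pi> = L @ (length L + length B + 1) # B" "length L = i"
      "set B \<noteq> {} \<and> card {x \<in> set L. \<forall>y\<in>set B. y < x} = j" "\<pi> \<in> separables_P k"
      "\<forall>x\<in>set L \<union> set B. x < length L + length B + 1" "interval_perm 0 (L @ B)" .
  have "\<exists>x\<in>set L. \<forall>y\<in>set B. y < x"
  proof (rule ccontr)
    assume "\<not> ?thesis"
    then have empty: "{x \<in> set L. \<forall>y\<in>set B. y < x} = {}" by blast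
    show False using \<pi>(3) assms(1) unfolding empty by simp
  qed
  from left_split[OF \<pi>(4)[unfolded \<pi>(1)] \<pi>(5) this]
  obtain A I where L: "L = A @ I" "I \<noteq> []" "below A I" "below B I" "\<forall>x\<in>set A. \<exists>y\<in>set B. x < y" .
  have "{x \<in> set L. \<forall>y\<in>set B. y < x} = set I"
  proof -
    have "\<not> (\<forall>y\<in>set B. y < x)" if "x \<in> set A" for x
    proof -
      have "\<exists>y\<in>set B. x < y" using L(5) that by (rule bspec)
      then obtain y where y: "y \<in> set B" "x < y" by (rule bexE)
      from y(2) have "\<not> y < x" by simp
      then show ?thesis using y(1) by blast
    qed
    moreover have "\<forall>y\<in>set B. y < x" if "x \<in> set I" for x
      using L(4) that unfolding below_def by blast
    ultimately show ?thesis unfolding L(1) set_append by blast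
  qed
  then have I: "length I = j"
    using \<pi>(3,6) L(1) by (simp add: distinct_card interval_perm_def)
  then have A: "length A = i - j" using \<pi>(2) L(1) by simp
  let ?\<sigma> = "A @ (length A + length B + 1) # B"
  have *: "A @ I @ (length L + length B + 1) # B \<in> separables_P k"
    using \<pi>(4) unfolding \<pi>(1) L(1) by simp
  have "length L + length B + 1 = length A + length B + length I + 1 \<and> ?\<sigma> \<in> separables_P k \<and>
      length A + length I + 1 < k \<and> (\<exists>J\<in>separables. I = map ((+) (length A + length B)) J)"
    by (rule left_block_iff[THEN iffD1, OF _ _ *]) (use L \<pi>(5) in \<open>auto simp: below_def\<close>)
  then obtain J where J: "J \<in> separables" "I = map ((+) (length A + length B)) J"
    and \<sigma>: "?\<sigma> \<in> separables_P k"
    by blast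
  have "x < length A + length B + 1" if "x \<in> set A \<union> set B" for x
    using separables_P_perm[OF \<sigma>] that by (rule interval_perm_max_less)
  moreover have "top_right (set A) (set B)"
  proof -
    have "Max (set B) \<in> set B" using \<pi>(3) by simp
    moreover have "x < Max (set B)" if x: "x \<in> set A" for x
    proof -
      obtain y where "y \<in> set B" "x < y" using L(5) x by blast
      then show ?thesis by (metis List.finite_set Max_ge less_le_trans)
    qed
    ultimately show ?thesis unfolding top_right_def by blast
  qed
  ultimately have "?\<sigma> \<in> ?S" using \<sigma> A by (subst max_at_iff) auto
  moreover have "J \<in> ?T" using J I by auto
  moreover have "\<pi> = ?h (J, ?\<sigma>)" using \<pi>(1) L(1) A J(2) by (simp add: insert_left_eq)
  ultimately show ?case by blast
qed

section \<open>The position of the maximum\<close>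

lemma graded_finite_separables: "graded_finite separables"
  unfolding graded_finite_def
proof
  fix n
  have "finite (separable_perms n)" by (simp add: separable_perms_def)
  then show "finite {\<pi> \<in> separables. length \<pi> = n}" by (simp add: separable_perms_eq)
qed

lemma graded_finite_separables_P: "graded_finite (separables_P k)"
  by (rule graded_finite_subset[OF graded_finite_separables]) (auto simp: separables_P_def)

lemma max_at_subset: "max_at k i P \<subseteq> separables_P k"
  by (auto simp: max_at_def)

lemma graded_finite_max_at: "graded_finite (max_at k i P)"
  by (rule graded_finite_subset[OF graded_finite_separables_P max_at_subset])

lemma gf_length:
  "gf W {\<pi> \<in> S. length \<pi> = j} = fps_const (\<Sum>\<pi> | \<pi> \<in> S \<and> length \<pi> = j. W \<pi>) * fps_X ^ j"
proof (rule fps_ext)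
  fix n
  have "{\<pi> \<in> {\<pi> \<in> S. length \<pi> = j}. length \<pi> = n} = (if n = j then {\<pi> \<in> S. length \<pi> = j} else {})"
    by auto
  then show "fps_nth (gf W {\<pi> \<in> S. length \<pi> = j}) n =
      fps_nth (fps_const (\<Sum>\<pi> | \<pi> \<in> S \<and> length \<pi> = j. W \<pi>) * fps_X ^ j) n"
    by (simp add: gf_def)
qed

lemma gf_separables_length:
  "gf (weight p q u v s t) {\<rho> \<in> separables. length \<rho> = j} =
    fps_const (X_poly j p q u v s t) * fps_X ^ j"
  by (simp add: gf_length X_poly_def separable_perms_eq)

lemma F_gf_eq: "k \<ge> 1 \<Longrightarrow> F_gf k p q u v s t = gf (weight p q u v s t) (separables_P k)"
  by (simp add: F_gf_def gf_def separable_P_perms_eq)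

lemma Nil_in_separables_P [simp]: "[] \<in> separables_P k"
  by (auto simp: separables_P_def separables_def interval_perm_def intro!: separableI)

lemma single_in_separables_P: "k \<ge> 2 \<Longrightarrow> [1] \<in> separables_P k"
  by (auto simp: separables_P_def separables_def interval_perm_def
      intro!: separableI dest: list_emb_length)

lemma weight_Nil [simp]: "weight p q u v s t [] = 1"
  by (simp add: weight_def statistics_eqs)

lemma weight_single: "weight p q u v s t [x] = u * v * s * t"
  by (simp add: weight_def)

lemma F_gf_minus_1:
  assumes "k \<ge> 1"
  shows "F_gf k p q u v s t - 1 = gf (weight p q u v s t) (separables_P k - {[]})"
proof -
  have "gf (weight p q u v s t) ({[]} \<union> (separables_P k - {[]})) =
      gf (weight p q u v s t) {[]} + gf (weight p q u v s t) (separables_P k - {[]})"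
    by (intro gf_Un graded_finite_subset[OF graded_finite_separables_P[of k]]) auto
  moreover have "{[]} \<union> (separables_P k - {[]}) = separables_P k" by auto
  ultimately show ?thesis using assms by (simp add: F_gf_eq gf_singleton)
qed

section \<open>From positions of the two largest entries to value sets\<close>

definition max_before_next :: "nat \<Rightarrow> nat \<Rightarrow> nat list set" where
  "max_before_next k i = {\<pi> \<in> separables_P k. i < length \<pi> \<and> \<pi> ! i = length \<pi> \<and>
     (length \<pi> \<ge> 2 \<longrightarrow> (\<exists>j. i < j \<and> j < length \<pi> \<and> \<pi> ! j = length \<pi> - 1))}"

definition max_after_next :: "nat \<Rightarrow> nat \<Rightarrow> nat list set" where
  "max_after_next k i = {\<pi> \<in> separables_P k. length \<pi> \<ge> 2 \<and> i < length \<pi> \<and> \<pi> ! i = length \<pi> \<and>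
     (\<exists>j < i. \<pi> ! j = length \<pi> - 1)}"

lemma f_gf_eq:
  assumes "k \<ge> 1"
  shows "f_gf k i p q u v s t = gf (weight p q u v s t) (max_before_next k i)"
proof (rule fps_ext)
  fix n
  show "fps_nth (f_gf k i p q u v s t) n = fps_nth (gf (weight p q u v s t) (max_before_next k i)) n"
  proof (cases "n \<ge> 1")
    case True
    have "{\<pi>. \<pi> \<in> separable_P_perms k n \<and> i < length \<pi> \<and> \<pi> ! i = n \<and>
            (n \<ge> 2 \<longrightarrow> (\<exists>j. i < j \<and> j < length \<pi> \<and> \<pi> ! j = n - 1))}
        = {\<pi>. \<pi> \<in> max_before_next k i \<and> length \<pi> = n}"
      using assms by (auto simp: max_before_next_def separable_P_perms_eq)
    then show ?thesis using True by (simp add: f_gf_def gf_def)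
  next
    case False
    then have empty: "{\<pi>. \<pi> \<in> max_before_next k i \<and> length \<pi> = n} = {}"
      by (auto simp: max_before_next_def)
    show ?thesis using False unfolding f_gf_def gf_def fps_nth_Abs_fps empty by simp
  qed
qed

lemma g_gf_eq:
  assumes "k \<ge> 1"
  shows "g_gf k i p q u v s t = gf (weight p q u v s t) (max_after_next k i)"
proof (rule fps_ext)
  fix n
  show "fps_nth (g_gf k i p q u v s t) n = fps_nth (gf (weight p q u v s t) (max_after_next k i)) n"
  proof (cases "n \<ge> 2")
    case True
    have "{\<pi>. \<pi> \<in> separable_P_perms k n \<and> i < length \<pi> \<and> \<pi> ! i = n \<and>
            (\<exists>j < i. \<pi> ! j = n - 1)}
        = {\<pi>. \<pi> \<in> max_after_next k i \<and> length \<pi> = n}"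
      using assms True by (auto simp: max_after_next_def separable_P_perms_eq)
    then show ?thesis using True by (simp add: g_gf_def gf_def)
  next
    case False
    then have empty: "{\<pi>. \<pi> \<in> max_after_next k i \<and> length \<pi> = n} = {}"
      by (auto simp: max_after_next_def)
    show ?thesis using False unfolding g_gf_def gf_def fps_nth_Abs_fps empty by simp
  qed
qed

lemma nth_split:
  assumes "\<pi> \<in> separables_P k" "i < length \<pi>" "\<pi> ! i = length \<pi>"
  obtains A R where "\<pi> = A @ (length A + length R + 1) # R" "length A = i"
    "\<forall>x\<in>set A \<union> set R. x < length A + length R + 1" "interval_perm 0 (A @ R)"
proof -
  define A R where "A = take i \<pi>" and "R = drop (Suc i) \<pi>"
  have len: "length A = i" "length \<pi> = length A + length R + 1"
    using assms(2) by (auto simp: A_def R_def)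
  have \<pi>: "\<pi> = A @ length \<pi> # R"
    using id_take_nth_drop[OF assms(2)] assms(3) by (simp add: A_def R_def)
  have perm: "interval_perm 0 \<pi>" using assms(1) by (rule separables_P_perm)
  have "x < length \<pi>" if "x \<in> set A \<union> set R" for x
  proof -
    have "x \<in> set \<pi>" using that by (subst \<pi>) auto
    then have "x \<le> length \<pi>" by (rule interval_perm_0_le[OF perm])
    moreover have "distinct (A @ length \<pi> # R)" using perm \<pi> by (simp add: interval_perm_def)
    ultimately show ?thesis using that by (auto simp: le_less)
  qed
  moreover from this have "interval_perm 0 (A @ R)"
    using max_perm[of A R "length \<pi>"] perm \<pi> by simp
  ultimately show thesis using that[of A R] len \<pi> by simp
qed

lemma ex_nth_right:
  "length A = i \<Longrightarrow>
    (\<exists>j. i < j \<and> j < length (A @ N # R) \<and> (A @ N # R) ! j = z) \<longleftrightarrow> z \<in> set R"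
proof
  assume "length A = i" "\<exists>j. i < j \<and> j < length (A @ N # R) \<and> (A @ N # R) ! j = z"
  then obtain j where "i < j" "j < i + length R + 1" "(A @ N # R) ! j = z" "length A = i" by auto
  then show "z \<in> set R" by (auto simp: nth_append nth_Cons' split: if_splits intro!: nth_mem)
next
  assume A: "length A = i" and "z \<in> set R"
  then obtain j where "j < length R" "R ! j = z" by (auto simp: in_set_conv_nth)
  then show "\<exists>j. i < j \<and> j < length (A @ N # R) \<and> (A @ N # R) ! j = z"
    using A by (intro exI[of _ "Suc (i + j)"]) (simp add: nth_append)
qed

lemma ex_nth_left:
  "length A = i \<Longrightarrow> (\<exists>j<i. (A @ N # R) ! j = z) \<longleftrightarrow> z \<in> set A"
  by (auto simp: nth_append in_set_conv_nth)

text \<open>The largest value next to the maximum is \<open>length A + length R\<close>; the side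
  that holds it is the one with an element above the whole other side.\<close>

lemma top_left_iff:
  assumes "interval_perm 0 (A @ R)"
  shows "top_left (set A) (set R) \<longleftrightarrow> length A + length R \<in> set A"
proof
  have un: "set A \<union> set R = {0<..length A + length R}" and dis: "set A \<inter> set R = {}"
    using assms by (auto simp: interval_perm_def)
  {
    assume "top_left (set A) (set R)"
    then obtain x where x: "x \<in> set A" "\<forall>y\<in>set R. y < x" by (auto simp: top_left_def)
    then have "x \<in> {0<..length A + length R}" using un by blast
    then have "length A + length R \<in> {0<..length A + length R}" "x \<le> length A + length R" by auto
    then show "length A + length R \<in> set A" using x(2) unfolding un[symmetric] by fastforce
  next
    assume *: "length A + length R \<in> set A"
    have "y < length A + length R" if "y \<in> set R" for y
    proof -
      have "y \<in> {0<..length A + length R}" using un that by blast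
      moreover have "y \<noteq> length A + length R" using * dis that by blast
      ultimately show ?thesis by simp
    qed
    then show "top_left (set A) (set R)" using * by (auto simp: top_left_def)
  }
qed

lemma top_right_iff:
  assumes "interval_perm 0 (A @ R)"
  shows "top_right (set A) (set R) \<longleftrightarrow> length A + length R \<in> set R"
proof -
  have "interval_perm 0 (R @ A)" using assms interval_perm_mset[of "R @ A" "A @ R" 0] by simp
  from top_left_iff[OF this] show ?thesis
    by (simp add: top_left_def top_right_def add.commute)
qed

lemma max_after_next_eq: "max_after_next k i = max_at k i top_left"
proof (intro equalityI subsetI)
  fix \<pi> assume "\<pi> \<in> max_after_next k i"
  then have \<pi>: "\<pi> \<in> separables_P k" "i < length \<pi>" "\<pi> ! i = length \<pi>" "\<exists>j < i. \<pi> ! j = length \<pi> - 1"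
    by (auto simp: max_after_next_def)
  from nth_split[OF this(1-3)] obtain A R where *: "\<pi> = A @ (length A + length R + 1) # R"
    "length A = i" "\<forall>x\<in>set A \<union> set R. x < length A + length R + 1" "interval_perm 0 (A @ R)" .
  have "length \<pi> - 1 = length A + length R" by (subst *(1)) simp
  then have "\<exists>j<i. (A @ (length A + length R + 1) # R) ! j = length A + length R"
    using \<pi>(4) unfolding *(1)[symmetric] by simp
  then have "length A + length R \<in> set A" unfolding ex_nth_left[OF *(2)] .
  then show "\<pi> \<in> max_at k i top_left"
    using \<pi>(1) * top_left_iff[OF *(4)] by (auto simp: max_at_def)
next
  fix \<pi> assume "\<pi> \<in> max_at k i top_left"
  from max_atE[OF this] obtain A R where *: "\<pi> = A @ (length A + length R + 1) # R"
    "length A = i" "top_left (set A) (set R)" "\<pi> \<in> separables_P k"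
    "\<forall>x\<in>set A \<union> set R. x < length A + length R + 1" "interval_perm 0 (A @ R)" .
  then have "length A + length R \<in> set A" by (simp add: top_left_iff)
  then have "\<exists>j<i. \<pi> ! j = length A + length R" "A \<noteq> []"
    unfolding *(1) using ex_nth_left[OF *(2)] by auto
  moreover have len: "length \<pi> = length A + length R + 1" by (subst *(1)) simp
  moreover have "\<pi> ! i = length \<pi>" unfolding len using *(2) by (subst *(1)) (simp add: nth_append)
  ultimately show "\<pi> \<in> max_after_next k i"
    using *(2,4) by (cases A) (auto simp: max_after_next_def)
qed

lemma max_before_next_eq:
  "max_before_next k i = max_at k i (\<lambda>X Y. top_right X Y \<or> X = {} \<and> Y = {})"
proof (intro equalityI subsetI)
  fix \<pi> assume "\<pi> \<in> max_before_next k i"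
  then have \<pi>: "\<pi> \<in> separables_P k" "i < length \<pi>" "\<pi> ! i = length \<pi>"
    "length \<pi> \<ge> 2 \<longrightarrow> (\<exists>j. i < j \<and> j < length \<pi> \<and> \<pi> ! j = length \<pi> - 1)"
    by (auto simp: max_before_next_def)
  from nth_split[OF this(1-3)] obtain A R where *: "\<pi> = A @ (length A + length R + 1) # R"
    "length A = i" "\<forall>x\<in>set A \<union> set R. x < length A + length R + 1" "interval_perm 0 (A @ R)" .
  have len: "length \<pi> = length A + length R + 1" by (subst *(1)) simp
  have "top_right (set A) (set R) \<or> set A = {} \<and> set R = {}"
  proof (cases "length \<pi> \<ge> 2")
    case True
    then have "\<exists>j. i < j \<and> j < length \<pi> \<and> \<pi> ! j = length A + length R" using \<pi>(4) len by simp
    then have "\<exists>j. i < j \<and> j < length (A @ (length A + length R + 1) # R) \<and>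
        (A @ (length A + length R + 1) # R) ! j = length A + length R"
      unfolding *(1)[symmetric] .
    then have "length A + length R \<in> set R" unfolding ex_nth_right[OF *(2)] .
    then show ?thesis using top_right_iff[OF *(4)] by simp
  next
    case False
    then have "length A + length R = 0" using len by linarith
    then show ?thesis by simp
  qed
  then show "\<pi> \<in> max_at k i (\<lambda>X Y. top_right X Y \<or> X = {} \<and> Y = {})"
    using \<pi>(1) * by (auto simp: max_at_def)
next
  fix \<pi> assume "\<pi> \<in> max_at k i (\<lambda>X Y. top_right X Y \<or> X = {} \<and> Y = {})"
  from max_atE[OF this] obtain A R where *: "\<pi> = A @ (length A + length R + 1) # R"
    "length A = i" "top_right (set A) (set R) \<or> set A = {} \<and> set R = {}" "\<pi> \<in> separables_P k"
    "\<forall>x\<in>set A \<union> set R. x < length A + length R + 1" "interval_perm 0 (A @ R)" .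
  have len: "length \<pi> = length A + length R + 1" by (subst *(1)) simp
  have "\<exists>j. i < j \<and> j < length \<pi> \<and> \<pi> ! j = length \<pi> - 1" if "length \<pi> \<ge> 2"
  proof -
    have "length A + length R \<in> set R"
      using that len *(3) top_right_iff[OF *(6)] by auto
    then have "\<exists>j. i < j \<and> j < length (A @ (length A + length R + 1) # R) \<and>
        (A @ (length A + length R + 1) # R) ! j = length A + length R"
      unfolding ex_nth_right[OF *(2)] .
    then show ?thesis unfolding *(1)[symmetric] by (simp add: len)
  qed
  moreover have "\<pi> ! i = length \<pi>" unfolding len using *(2) by (subst *(1)) (simp add: nth_append)
  ultimately show "\<pi> \<in> max_before_next k i"
    using *(2,4) len by (auto simp: max_before_next_def)
qed

lemma max_at_cong:
  assumes "\<And>A R. length A = i \<Longrightarrow> P (set A) (set R) \<longleftrightarrow> Q (set A) (set R)"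
  shows "max_at k i P = max_at k i Q"
  unfolding max_at_def by (intro Collect_cong conj_cong refl ex_cong1) (simp add: assms)

lemma max_before_next_pos: "1 \<le> i \<Longrightarrow> max_before_next k i = max_at k i top_right"
  unfolding max_before_next_eq by (rule max_at_cong) auto

lemma max_before_next_0:
  assumes "k \<ge> 2"
  shows "max_before_next k 0 = {[1]} \<union> max_at k 0 top_right"
proof -
  have "max_at k 0 (\<lambda>X Y. top_right X Y \<or> X = {} \<and> Y = {}) =
      max_at k 0 (\<lambda>X Y. X = {} \<and> Y = {}) \<union> max_at k 0 top_right"
    by (auto simp: max_at_def)
  moreover have "max_at k 0 (\<lambda>X Y. X = {} \<and> Y = {}) = {[1]}"
  proof (intro equalityI subsetI)
    fix \<pi> assume "\<pi> \<in> max_at k 0 (\<lambda>X Y. X = {} \<and> Y = {})"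
    from max_atE[OF this] show "\<pi> \<in> {[1]}" by auto
  next
    fix \<pi> assume "\<pi> \<in> {[1::nat]}"
    then show "\<pi> \<in> max_at k 0 (\<lambda>X Y. X = {} \<and> Y = {})"
      using single_in_separables_P[OF assms] max_at_iff[of "[]" 0 1 "[]" k] by simp
  qed
  ultimately show ?thesis by (simp add: max_before_next_eq)
qed

text \<open>The range of \<open>i\<close> ends at \<open>k - 2\<close> because the bound at the
  maximum allows no more entries before it.\<close>

lemma separables_P_decomp:
  assumes "k \<ge> 2"
  shows "separables_P k = {[]} \<union> (\<Union>i\<in>{0..k-2}. max_before_next k i \<union> max_after_next k i)"
proof (intro equalityI subsetI)
  fix \<pi> assume \<pi>: "\<pi> \<in> separables_P k"
  show "\<pi> \<in> {[]} \<union> (\<Union>i\<in>{0..k-2}. max_before_next k i \<union> max_after_next k i)"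
  proof (cases "\<pi> = []")
    case False
    have set: "set \<pi> = {0<..length \<pi>}" using separables_P_perm[OF \<pi>] by (simp add: interval_perm_def)
    then have "length \<pi> \<in> set \<pi>" using False by auto
    then obtain i where i: "i < length \<pi>" "\<pi> ! i = length \<pi>" by (metis in_set_conv_nth)
    from nth_split[OF \<pi> i] obtain A R where *: "\<pi> = A @ (length A + length R + 1) # R"
      "length A = i" "\<forall>x\<in>set A \<union> set R. x < length A + length R + 1" .
    have "below_bounded k [] \<pi>" using \<pi> by (simp add: separables_P_def)
    then have "i + 1 < k" using max_bounded[of A R "length A + length R + 1" k] * by auto
    then have "i \<in> {0..k-2}" by auto
    moreover have "\<pi> \<in> max_before_next k i \<union> max_after_next k i"
    proof (cases "length \<pi> \<ge> 2")
      case True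
      then have "length \<pi> - 1 \<in> set \<pi>" using set by auto
      then obtain j where j: "j < length \<pi>" "\<pi> ! j = length \<pi> - 1" by (metis in_set_conv_nth)
      then have "j \<noteq> i" using i True by auto
      then have "j < i \<or> i < j" by auto
      then show ?thesis using \<pi> i j True by (auto simp: max_before_next_def max_after_next_def)
    next
      case False
      then show ?thesis using \<pi> i by (auto simp: max_before_next_def)
    qed
    ultimately show ?thesis by blast
  qed simp
next
  fix \<pi> assume "\<pi> \<in> {[]} \<union> (\<Union>i\<in>{0..k-2}. max_before_next k i \<union> max_after_next k i)"
  then show "\<pi> \<in> separables_P k" by (auto simp: max_before_next_def max_after_next_def)
qed

lemma F_gf_decomp:
  assumes "k \<ge> 2"
  shows "F_gf k p q u v s t = 1 + (\<Sum>i=0..k-2. f_gf k i p q u v s t + g_gf k i p q u v s t)"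
proof -
  let ?W = "weight p q u v s t"
  have nth_eq: "i = j" if "\<pi> \<in> separables_P k" "i < length \<pi>" "j < length \<pi>" "\<pi> ! i = \<pi> ! j" for \<pi> i j
    using separables_P_perm[OF that(1)] that(2-) by (auto simp: interval_perm_def nth_eq_iff_index_eq)
  have sub: "max_before_next k i \<union> max_after_next k i \<subseteq> separables_P k" for i
    by (auto simp: max_before_next_def max_after_next_def)
  have "gf ?W (\<Union>i\<in>{0..k-2}. max_before_next k i \<union> max_after_next k i) =
      (\<Sum>i=0..k-2. gf ?W (max_before_next k i \<union> max_after_next k i))"
  proof (rule gf_UN)
    show "graded_finite (\<Union>i\<in>{0..k-2}. max_before_next k i \<union> max_after_next k i)"
      by (rule graded_finite_subset[OF graded_finite_separables_P[of k]]) (use sub in blast)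
    fix i j :: nat assume "i \<noteq> j"
    show "(max_before_next k i \<union> max_after_next k i) \<inter> (max_before_next k j \<union> max_after_next k j) = {}"
    proof (rule equals0I)
      fix \<pi>
      assume "\<pi> \<in> (max_before_next k i \<union> max_after_next k i) \<inter> (max_before_next k j \<union> max_after_next k j)"
      then have "\<pi> \<in> separables_P k" "i < length \<pi>" "j < length \<pi>" "\<pi> ! i = \<pi> ! j"
        unfolding max_before_next_def max_after_next_def by auto
      then show False using nth_eq \<open>i \<noteq> j\<close> by blast
    qed
  qed simp
  also have "\<dots> = (\<Sum>i=0..k-2. f_gf k i p q u v s t + g_gf k i p q u v s t)"
  proof (rule sum.cong[OF refl])
    fix i
    have "max_before_next k i \<inter> max_after_next k i = {}"
    proof (rule equals0I)
      fix \<pi> assume "\<pi> \<in> max_before_next k i \<inter> max_after_next k i"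
      then obtain j j' where "\<pi> \<in> separables_P k" "i < j" "j < length \<pi>" "j' < i" "i < length \<pi>"
          "\<pi> ! j = length \<pi> - 1" "\<pi> ! j' = length \<pi> - 1"
        by (auto simp: max_before_next_def max_after_next_def)
      then show False using nth_eq[of \<pi> j j'] by auto
    qed
    then have "gf ?W (max_before_next k i \<union> max_after_next k i) =
        gf ?W (max_before_next k i) + gf ?W (max_after_next k i)"
      by (intro gf_Un graded_finite_subset[OF graded_finite_separables_P[of k]])
        (use sub[of i] in auto)
    then show "gf ?W (max_before_next k i \<union> max_after_next k i) =
        f_gf k i p q u v s t + g_gf k i p q u v s t"
      using assms by (simp add: f_gf_eq g_gf_eq)
  qed
  finally have "gf ?W (\<Union>i\<in>{0..k-2}. max_before_next k i \<union> max_after_next k i) =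
    (\<Sum>i=0..k-2. f_gf k i p q u v s t + g_gf k i p q u v s t)" .
  moreover have "separables_P k - {[]} = (\<Union>i\<in>{0..k-2}. max_before_next k i \<union> max_after_next k i)"
  proof -
    have "[] \<notin> (\<Union>i\<in>{0..k-2}. max_before_next k i \<union> max_after_next k i)"
      by (auto simp: max_before_next_def max_after_next_def)
    then show ?thesis using separables_P_decomp[OF assms] by blast
  qed
  ultimately show ?thesis
    using F_gf_minus_1[of k p q u v s t] assms by (simp add: algebra_simps)
qed

section \<open>The recursions\<close>

text \<open>Taking away everything before the maximum as a left block leaves \<open>[1]\<close>. The
  factor \<open>{[]}\<close> is a dummy that gives the product form required by
  \<open>gf_prod\<close>.\<close>

lemma bij_snoc_max:
  assumes "1 \<le> i" "i + 1 < k"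
  shows "bij_betw (\<lambda>(\<alpha>, \<beta>). \<alpha> @ [length \<alpha> + 1]) ({\<alpha> \<in> separables. length \<alpha> = i} \<times> {[]})
    (max_at k i (\<lambda>X Y. top_left X Y \<and> (Y = {} \<longleftrightarrow> True)))"
    (is "bij_betw ?h (?S \<times> {[]}) ?U")
proof (rule bij_betwI', goal_cases)
  case (2 z)
  then obtain \<alpha> where z: "z = (\<alpha>, [])" "\<alpha> \<in> separables" "length \<alpha> = i" by auto
  then have perm: "interval_perm 0 \<alpha>" by (simp add: separables_def)
  then have "x < length \<alpha> + 1" if "x \<in> set \<alpha>" for x using interval_perm_0_le[OF perm that] by simp
  moreover from this have "[] @ \<alpha> @ (length \<alpha> + 1) # [] \<in> separables_P k"
    using z assms single_in_separables_P[of k] by (subst left_block_iff) (auto simp: map_idI)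
  moreover have "top_left (set \<alpha>) (set [])" using z assms by (cases \<alpha>) (auto simp: top_left_def)
  ultimately have "\<alpha> @ [length \<alpha> + 1] \<in> ?U" using z by (subst max_at_iff) auto
  then show ?case by (simp add: z)
next
  case (3 \<pi>)
  from max_atE[OF 3] obtain A R where \<pi>: "\<pi> = A @ (length A + length R + 1) # R" "length A = i"
      "top_left (set A) (set R) \<and> (set R = {} \<longleftrightarrow> True)" "\<pi> \<in> separables_P k"
      "\<forall>x\<in>set A \<union> set R. x < length A + length R + 1" "interval_perm 0 (A @ R)" .
  then have R: "R = []" by simp
  have *: "[] @ A @ (length A + 1) # [] \<in> separables_P k" using \<pi>(4) unfolding \<pi>(1) R by simp
  have "x < length A + 1" if "x \<in> set A" for x using \<pi>(5) R that by simp
  then have "A \<in> separables"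
    using left_block_iff[of "[]" "[]" A "length A + 1" k] * by (auto simp: map_idI)
  then have "(A, []) \<in> ?S \<times> {[]}" using \<pi>(2) by simp
  moreover have "\<pi> = ?h (A, [])" using \<pi>(1) R by simp
  ultimately show ?case by blast
qed auto

text \<open>Everything behind the maximum is a right block. Nothing precedes it, so it keeps the
  full bound \<open>k\<close>. The factor \<open>{[]}\<close> is again a dummy.\<close>

lemma bij_Cons_max:
  assumes "k \<ge> 2"
  shows "bij_betw (\<lambda>(\<alpha>, \<beta>). (length \<beta> + 1) # \<beta>) ({[]} \<times> (separables_P k - {[]}))
    (max_at k 0 top_right)"
    (is "bij_betw ?h ({[]} \<times> ?T) ?U")
proof (rule bij_betwI', goal_cases)
  case (2 z)
  then obtain \<beta> where z: "z = ([], \<beta>)" "\<beta> \<in> separables_P k" "\<beta> \<noteq> []" by auto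
  then have perm: "interval_perm 0 \<beta>" by (simp add: separables_P_perm)
  then have "x < length \<beta> + 1" if "x \<in> set \<beta>" for x using interval_perm_0_le[OF perm that] by simp
  moreover from this have "[] @ (length \<beta> + 1) # \<beta> @ [] \<in> separables_P k"
    using z assms single_in_separables_P[of k] by (subst right_block_iff) (auto simp: map_idI)
  moreover have "top_right (set []) (set \<beta>)" using z by (cases \<beta>) (auto simp: top_right_def)
  ultimately have "[] @ (length \<beta> + 1) # \<beta> \<in> ?U" using z by (subst max_at_iff) auto
  then show ?case by (simp add: z)
next
  case (3 \<pi>)
  from max_atE[OF 3] obtain A R where \<pi>: "\<pi> = A @ (length A + length R + 1) # R" "length A = 0"
      "top_right (set A) (set R)" "\<pi> \<in> separables_P k"
      "\<forall>x\<in>set A \<union> set R. x < length A + length R + 1" "interval_perm 0 (A @ R)" .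
  then have A: "A = []" by simp
  have *: "[] @ (length R + 1) # R @ [] \<in> separables_P k" using \<pi>(4) unfolding \<pi>(1) A by simp
  have "x < length R + 1" if "x \<in> set R" for x using \<pi>(5) A that by simp
  then have "R \<in> separables_P k"
    using right_block_iff[of "[]" "[]" R "length R + 1" k] * by (auto simp: map_idI)
  moreover have "R \<noteq> []" using \<pi>(3) by (auto simp: top_right_def)
  ultimately have "([], R) \<in> {[]} \<times> ?T" by simp
  moreover have "\<pi> = ?h ([], R)" using \<pi>(1) A by simp
  ultimately show ?case by blast
qed auto

lemma graded_finite_single: "graded_finite {\<pi>}"
  by (auto simp: graded_finite_def)

lemma graded_finite_separables_length: "graded_finite {\<rho> \<in> separables. length \<rho> = j}"
  by (rule graded_finite_subset[OF graded_finite_separables]) auto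

lemma graded_finite_separables_P_nonempty: "graded_finite (separables_P k - {[]})"
  by (rule graded_finite_subset[OF graded_finite_separables_P]) auto

lemmas graded_finite_intros = graded_finite_single graded_finite_separables_length
  graded_finite_separables_P_nonempty graded_finite_max_at

lemma max_at_disjoint:
  assumes "\<And>X Y. P X Y \<Longrightarrow> \<not> Q X Y"
  shows "max_at k i P \<inter> max_at k i Q = {}"
proof (rule equals0I)
  fix \<pi> assume "\<pi> \<in> max_at k i P \<inter> max_at k i Q"
  then have P: "\<pi> \<in> max_at k i P" and Q: "\<pi> \<in> max_at k i Q" by simp_all
  from max_atE[OF P] obtain A R where
    \<pi>: "\<pi> = A @ (length A + length R + 1) # R" "length A = i" "P (set A) (set R)" .
  from Q have "Q (set A) (set R)" unfolding \<pi>(1) max_at_iff[OF \<pi>(2)] by blast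
  then show False using assms \<pi>(3) by blast
qed

text \<open>Comparing \<open>Q\<close> with \<open>True\<close> and \<open>False\<close> makes both
  parts instances of the family that \<open>bij_insert_right\<close> indexes by its flag.\<close>

lemma gf_max_at_split:
  "gf W (max_at k i P) = gf W (max_at k i (\<lambda>X Y. P X Y \<and> (Q X Y \<longleftrightarrow> True))) +
    gf W (max_at k i (\<lambda>X Y. P X Y \<and> (Q X Y \<longleftrightarrow> False)))" (is "_ = gf W ?T + gf W ?F")
proof -
  have "max_at k i P = max_at k i (\<lambda>X Y. P X Y \<and> (Q X Y \<longleftrightarrow> True) \<or> P X Y \<and> (Q X Y \<longleftrightarrow> False))"
    by (rule max_at_cong) auto
  also have "\<dots> = ?T \<union> ?F" unfolding max_at_def by blast
  finally have "max_at k i P = ?T \<union> ?F" .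
  moreover have "?T \<inter> ?F = {}" by (rule max_at_disjoint) blast
  ultimately show ?thesis by (simp only: gf_Un graded_finite_max_at)
qed

text \<open>\<open>W\<close> is left open for two uses: the full weight, and a partial weight that
  reads only the entries before the maximum.\<close>

lemma gf_snoc_max:
  assumes i: "1 \<le> i" "i + 1 < k"
    and W: "\<And>A. A \<in> separables \<Longrightarrow> length A = i \<Longrightarrow> W (A @ [length A + 1]) = c * weight p q u v s t A"
  shows "gf W (max_at k i (\<lambda>X Y. top_left X Y \<and> (Y = {} \<longleftrightarrow> True))) =
    fps_const c * fps_X ^ (i + 1) * fps_const (X_poly i p q u v s t)"
proof -
  have "gf W (max_at k i (\<lambda>X Y. top_left X Y \<and> (Y = {} \<longleftrightarrow> True))) =
      fps_const c * fps_X ^ 1 * gf (weight p q u v s t) {\<alpha> \<in> separables. length \<alpha> = i} *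
      gf (\<lambda>_. 1) {[]}"
    by (rule gf_prod[OF bij_snoc_max[OF i]]) (auto intro: graded_finite_intros simp: W[simplified])
  also have "\<dots> = fps_const c * fps_X ^ (i + 1) * fps_const (X_poly i p q u v s t)"
    by (simp add: gf_singleton gf_separables_length mult_ac fps_const_mult[symmetric]
        del: fps_const_mult)
  finally show ?thesis .
qed

lemma gf_Cons_max:
  assumes k: "k \<ge> 2"
    and W: "\<And>B. B \<in> separables_P k \<Longrightarrow> B \<noteq> [] \<Longrightarrow> W ((length B + 1) # B) = c * weight p q u v s t B"
  shows "gf W (max_at k 0 top_right) = fps_const c * fps_X * (F_gf k p q u v s t - 1)"
proof -
  have "gf W (max_at k 0 top_right) =
      fps_const c * fps_X ^ 1 * gf (\<lambda>_. 1) {[]} * gf (weight p q u v s t) (separables_P k - {[]})"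
    by (rule gf_prod[OF bij_Cons_max[OF k]]) (auto intro: graded_finite_intros simp: W[simplified])
  then show ?thesis
    using k by (simp add: gf_singleton F_gf_minus_1)
qed

lemma f_gf_0:
  assumes "k \<ge> 2"
  shows "f_gf k 0 p q u v s t = fps_const (u*v*s*t) * fps_X
    + fps_const (q*u*v*s) * fps_X * (F_gf k p q 1 v s t - 1)"
proof -
  have "f_gf k 0 p q u v s t = gf (weight p q u v s t) ({[1]} \<union> max_at k 0 top_right)"
    using assms by (simp add: f_gf_eq max_before_next_0)
  also have "\<dots> = gf (weight p q u v s t) {[1]} + gf (weight p q u v s t) (max_at k 0 top_right)"
  proof (intro gf_Un graded_finite_intros equals0I)
    fix \<pi> assume "\<pi> \<in> {[1]} \<inter> max_at k 0 top_right"
    then show False by (auto simp: max_at_def top_right_def append_eq_Cons_conv)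
  qed
  also have "gf (weight p q u v s t) (max_at k 0 top_right) =
      fps_const (q*u*v*s) * fps_X * (F_gf k p q 1 v s t - 1)"
  proof (rule gf_Cons_max[OF assms])
    fix B assume "B \<in> separables_P k" "B \<noteq> []"
    then show "weight p q u v s t ((length B + 1) # B) = q * u * v * s * weight p q 1 v s t B"
      using interval_perm_0_le[OF separables_P_perm] by (intro weight_Cons_max) force+
  qed
  finally show ?thesis by (simp add: gf_singleton weight_single)
qed

lemma g_gf_0: "k \<ge> 1 \<Longrightarrow> g_gf k 0 p q u v s t = 0"
  by (simp add: g_gf_eq max_after_next_def)

section \<open>The recursions for a maximum that is not in front\<close>

context
  fixes p q u v s t :: "'a :: comm_ring_1" and k i :: nat
  assumes i: "1 \<le> i" "i + 1 < k"
begin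

lemma gf_max_last:
  "gf (weight p q u v s t) (max_at k i (\<lambda>X Y. top_left X Y \<and> (Y = {} \<longleftrightarrow> True))) =
    fps_const (p*u*v*t) * fps_X ^ (i + 1) * fps_const (X_poly i p q u 1 s t)"
proof (rule gf_snoc_max[OF i])
  fix A assume "A \<in> separables" "length A = i"
  then show "weight p q u v s t (A @ [length A + 1]) = p * u * v * t * weight p q u 1 s t A"
    using i interval_perm_0_le[of A] by (intro weight_snoc_max) (force simp: separables_def)+
qed

text \<open>If \<open>b\<close> holds, the final maximum of \<open>\<sigma>\<close> is a
  right-to-left minimum, but no longer once the block follows. As \<open>t\<close> cannot be divided
  out in a ring, the factor is expressed through \<open>take i \<sigma>\<close> instead of the
  weight of \<open>\<sigma>\<close>.\<close>

lemma insert_right_weights: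
  assumes "\<sigma> \<in> max_at k i (\<lambda>X Y. top_left X Y \<and> (Y = {} \<longleftrightarrow> b))" "\<rho> \<in> separables_P (k - i) - {[]}"
  shows "length (insert_right i \<sigma> \<rho>) = 0 + length \<sigma> + length \<rho>"
    and "b \<Longrightarrow> weight p q u v s t (insert_right i \<sigma> \<rho>) =
      q * (p * u * v * weight p q u 1 s t (take i \<sigma>)) * weight p q 1 v 1 t \<rho>"
    and "\<not> b \<Longrightarrow> weight p q u v s t (insert_right i \<sigma> \<rho>) =
      q * weight p q u v s t \<sigma> * weight p q 1 v 1 1 \<rho>"
proof -
  from max_atE[OF assms(1)] obtain A B where \<sigma>: "\<sigma> = A @ (length A + length B + 1) # B" "length A = i"
      "top_left (set A) (set B) \<and> (set B = {} \<longleftrightarrow> b)" "\<sigma> \<in> separables_P k"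
      "\<forall>x\<in>set A \<union> set B. x < length A + length B + 1" "interval_perm 0 (A @ B)" .
  let ?I = "map ((+) (length A + length B)) \<rho>" and ?N = "length A + length B + length \<rho> + 1"
  have len: "length \<sigma> = length A + length B + 1" by (subst \<sigma>(1)) simp
  have eq: "insert_right i \<sigma> \<rho> = A @ ?N # ?I @ B"
    unfolding \<sigma>(1) by (rule insert_right_eq[OF \<sigma>(2)])
  show "length (insert_right i \<sigma> \<rho>) = 0 + length \<sigma> + length \<rho>"
    unfolding eq by (simp add: len)
  have \<rho>: "interval_perm 0 \<rho>" "?I \<noteq> []" using assms(2) by (auto dest: separables_P_perm)
  note sb = shifted_block[OF \<rho>(1) \<sigma>(6) length_append]
  have A: "A \<noteq> []" using \<sigma>(2) i by auto
  {
    assume b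
    then have B: "B = []" using \<sigma>(3) by simp
    have "weight p q u v s t (A @ ?N # ?I) =
        p * q * u * v * weight p q u 1 s t A * weight p q 1 v 1 t ?I"
      by (rule weight_right_block_last) (use A \<rho> sb B in \<open>auto simp: below_def\<close>)
    moreover have "take i \<sigma> = A" by (subst \<sigma>(1)) (simp add: \<sigma>(2))
    ultimately show "weight p q u v s t (insert_right i \<sigma> \<rho>) =
        q * (p * u * v * weight p q u 1 s t (take i \<sigma>)) * weight p q 1 v 1 t \<rho>"
      unfolding eq by (simp add: B weight_map_add ac_simps)
  next
    assume "\<not> b"
    then have B: "B \<noteq> []" using \<sigma>(3) by auto
    have "weight p q u v s t (A @ ?N # ?I @ B) =
        q * weight p q u v s t (A @ (length A + length B + 1) # B) * weight p q 1 v 1 1 ?I"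
      by (rule weight_right_block) (use A B \<rho> sb \<sigma>(5) in \<open>auto simp: below_def\<close>)
    then show "weight p q u v s t (insert_right i \<sigma> \<rho>) =
        q * weight p q u v s t \<sigma> * weight p q 1 v 1 1 \<rho>"
      unfolding eq by (subst \<sigma>(1)) (simp add: weight_map_add)
  }
qed

text \<open>The two summands are the blocks that end the permutation and those that do not. The
  second keeps the series of permutations with an entry behind the maximum, which
  \<open>gf_left_rec\<close> expands and \<open>g_gf_split\<close> relates to
  \<open>g_gf\<close>.\<close>

lemma f_gf_rec:
  "f_gf k i p q u v s t =
    fps_const (p*q*u*v) * fps_X ^ (i + 1) * fps_const (X_poly i p q u 1 s t) * (F_gf (k - i) p q 1 v 1 t - 1)
    + fps_const q * gf (weight p q u v s t) (max_at k i (\<lambda>X Y. top_left X Y \<and> (Y = {} \<longleftrightarrow> False)))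
      * (F_gf (k - i) p q 1 v 1 1 - 1)"
proof -
  let ?W = "weight p q u v s t"
  let ?U = "\<lambda>b. max_at k i (\<lambda>X Y. top_right X Y \<and> ((\<forall>x\<in>X. \<forall>y\<in>Y. x < y) \<longleftrightarrow> b))"
  let ?S = "\<lambda>b. max_at k i (\<lambda>X Y. top_left X Y \<and> (Y = {} \<longleftrightarrow> b))"
  have "gf ?W (max_at k i top_right) = gf ?W (?U True) + gf ?W (?U False)"
    by (rule gf_max_at_split)
  moreover have "gf ?W (?U True) = fps_const q * fps_X ^ 0 *
      gf (\<lambda>\<sigma>. p * u * v * weight p q u 1 s t (take i \<sigma>)) (?S True) *
      gf (weight p q 1 v 1 t) (separables_P (k - i) - {[]})"
    by (rule gf_prod[OF bij_insert_right[OF i(1)]])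
      (rule graded_finite_intros insert_right_weights(1) insert_right_weights(2) TrueI | assumption)+
  moreover have "gf (\<lambda>\<sigma>. p * u * v * weight p q u 1 s t (take i \<sigma>)) (?S True) =
      fps_const (p*u*v) * fps_X ^ (i + 1) * fps_const (X_poly i p q u 1 s t)"
    by (rule gf_snoc_max[OF i]) simp
  moreover have "gf ?W (?U False) = fps_const q * fps_X ^ 0 * gf ?W (?S False) *
      gf (weight p q 1 v 1 1) (separables_P (k - i) - {[]})"
    by (rule gf_prod[OF bij_insert_right[OF i(1)]])
      (rule graded_finite_intros insert_right_weights(1) insert_right_weights(3) notI | assumption)+
  moreover have "f_gf k i p q u v s t = gf ?W (max_at k i top_right)"
    using i by (simp add: f_gf_eq max_before_next_pos)
  ultimately show ?thesis
    using i by (simp add: F_gf_minus_1 fps_const_mult[symmetric] algebra_simps del: fps_const_mult)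
qed

text \<open>For \<open>j = i\<close> the permutation \<open>\<sigma>\<close> begins with its
  maximum, a left-to-right minimum that is lost once the block is put in front. The factor is
  therefore expressed through \<open>tl \<sigma>\<close>.\<close>

lemma insert_left_weights:
  assumes j: "1 \<le> j" "j \<le> i" and \<sigma>: "\<sigma> \<in> max_at k (i - j) top_right"
    and \<rho>: "\<rho> \<in> {\<rho> \<in> separables. length \<rho> = j}"
  shows "length (insert_left (i - j) \<rho> \<sigma>) = 0 + length \<rho> + length \<sigma>"
    and "j < i \<Longrightarrow> weight p q u v s t (insert_left (i - j) \<rho> \<sigma>) =
      p * weight p q u 1 1 1 \<rho> * weight p q u v s t \<sigma>"
    and "j = i \<Longrightarrow> weight p q u v s t (insert_left (i - j) \<rho> \<sigma>) =
      p * q * u * v * weight p q u 1 s 1 \<rho> * weight p q 1 v s t (tl \<sigma>)"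
proof -
  from max_atE[OF \<sigma>] obtain A B where \<sigma>: "\<sigma> = A @ (length A + length B + 1) # B" "length A = i - j"
      "top_right (set A) (set B)" "\<sigma> \<in> separables_P k"
      "\<forall>x\<in>set A \<union> set B. x < length A + length B + 1" "interval_perm 0 (A @ B)" .
  let ?I = "map ((+) (length A + length B)) \<rho>" and ?N = "length A + length B + length \<rho> + 1"
  have len: "length \<sigma> = length A + length B + 1" by (subst \<sigma>(1)) simp
  have eq: "insert_left (i - j) \<rho> \<sigma> = A @ ?I @ ?N # B"
    unfolding \<sigma>(1) by (rule insert_left_eq[OF \<sigma>(2)])
  show "length (insert_left (i - j) \<rho> \<sigma>) = 0 + length \<rho> + length \<sigma>"
    unfolding eq by (simp add: len)
  have \<rho>: "interval_perm 0 \<rho>" "?I \<noteq> []" using \<rho> j by (auto simp: separables_def)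
  note sb = shifted_block[OF \<rho>(1) \<sigma>(6) length_append]
  have B: "B \<noteq> []" using \<sigma>(3) by (auto simp: top_right_def)
  {
    assume "j < i"
    then have A: "A \<noteq> []" using \<sigma>(2) by auto
    have "weight p q u v s t (A @ ?I @ ?N # B) =
        p * weight p q u 1 1 1 ?I * weight p q u v s t (A @ (length A + length B + 1) # B)"
      by (rule weight_left_block) (use A B \<rho> sb \<sigma>(5) in \<open>auto simp: below_def\<close>)
    then show "weight p q u v s t (insert_left (i - j) \<rho> \<sigma>) =
        p * weight p q u 1 1 1 \<rho> * weight p q u v s t \<sigma>"
      unfolding eq by (subst \<sigma>(1)) (simp add: weight_map_add)
  next
    assume "j = i"
    then have A: "A = []" using \<sigma>(2) by simp
    have "weight p q u v s t (?I @ ?N # B) =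
        p * q * u * v * weight p q u 1 s 1 ?I * weight p q 1 v s t B"
      by (rule weight_left_block_first) (use A B \<rho> sb in \<open>auto simp: below_def\<close>)
    moreover have "tl \<sigma> = B" by (subst \<sigma>(1)) (simp add: A)
    ultimately show "weight p q u v s t (insert_left (i - j) \<rho> \<sigma>) =
        p * q * u * v * weight p q u 1 s 1 \<rho> * weight p q 1 v s t (tl \<sigma>)"
      unfolding eq by (simp add: A weight_map_add)
  }
qed

text \<open>Classifies by the length of the left block, that is, by the number of left values above
  the whole right side; \<open>top_left\<close> says that this number is positive.\<close>

lemma max_at_left_decomp:
  "max_at k i (\<lambda>X Y. top_left X Y \<and> (Y = {} \<longleftrightarrow> False)) =
    (\<Union>j\<in>{1..i}. max_at k i (\<lambda>X Y. Y \<noteq> {} \<and> card {x \<in> X. \<forall>y\<in>Y. y < x} = j))"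
proof -
  have "top_left (set A) (set R) \<longleftrightarrow> card {x \<in> set A. \<forall>y\<in>set R. y < x} \<in> {1..i}" if "length A = i" for A R
  proof -
    have "card {x \<in> set A. \<forall>y\<in>set R. y < x} \<le> card (set A)" by (rule card_mono) auto
    also have "\<dots> \<le> i" using card_length[of A] that by simp
    finally have "card {x \<in> set A. \<forall>y\<in>set R. y < x} \<in> {1..i} \<longleftrightarrow> {x \<in> set A. \<forall>y\<in>set R. y < x} \<noteq> {}"
      by (simp add: Suc_le_eq card_gt_0_iff)
    then show ?thesis by (auto simp: top_left_def)
  qed
  then have "max_at k i (\<lambda>X Y. top_left X Y \<and> (Y = {} \<longleftrightarrow> False)) =
      max_at k i (\<lambda>X Y. card {x \<in> X. \<forall>y\<in>Y. y < x} \<in> {1..i} \<and> Y \<noteq> {})"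
    by (intro max_at_cong) simp
  also have "\<dots> = (\<Union>j\<in>{1..i}. max_at k i (\<lambda>X Y. Y \<noteq> {} \<and> card {x \<in> X. \<forall>y\<in>Y. y < x} = j))"
    unfolding max_at_def by blast
  finally show ?thesis .
qed

lemma gf_left_rec:
  "gf (weight p q u v s t) (max_at k i (\<lambda>X Y. top_left X Y \<and> (Y = {} \<longleftrightarrow> False))) =
    fps_const (p*q*u*v) * fps_X ^ (i + 1) * fps_const (X_poly i p q u 1 s 1) * (F_gf k p q 1 v s t - 1)
    + (\<Sum>j=1..i-1. fps_const p * fps_const (X_poly j p q u 1 1 1) * fps_X ^ j * f_gf k (i - j) p q u v s t)"
proof -
  let ?W = "weight p q u v s t"
  let ?U = "\<lambda>j. max_at k i (\<lambda>X Y. Y \<noteq> {} \<and> card {x \<in> X. \<forall>y\<in>Y. y < x} = j)"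
  have "gf ?W (\<Union>j\<in>{1..i}. ?U j) = (\<Sum>j=1..i. gf ?W (?U j))"
  proof (rule gf_UN)
    show "graded_finite (\<Union>j\<in>{1..i}. ?U j)"
      unfolding max_at_left_decomp[symmetric] by (rule graded_finite_max_at)
    show "?U j \<inter> ?U j' = {}" if "j \<noteq> j'" for j j'
      using that by (intro max_at_disjoint) blast
  qed simp
  also have "(\<Sum>j=1..i. gf ?W (?U j)) = gf ?W (?U i) + (\<Sum>j=1..i-1. gf ?W (?U j))"
  proof -
    have "{1..i} = insert i {1..i-1}" using i by auto
    then show ?thesis using i by simp
  qed
  also have "gf ?W (?U i) =
      fps_const (p*q*u*v) * fps_X ^ (i + 1) * fps_const (X_poly i p q u 1 s 1) * (F_gf k p q 1 v s t - 1)"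
  proof -
    have "gf ?W (?U i) = fps_const (p*q*u*v) * fps_X ^ 0 *
        gf (weight p q u 1 s 1) {\<rho> \<in> separables. length \<rho> = i} *
        gf (\<lambda>\<sigma>. weight p q 1 v s t (tl \<sigma>)) (max_at k (i - i) top_right)"
      by (rule gf_prod[OF bij_insert_left[OF i(1) order.refl i(2)]])
        (rule graded_finite_intros insert_left_weights(1,3) i(1) order.refl refl | assumption)+
    \<comment> \<open>The constant is 1 because the contribution of the maximum to the weight
      already sits in \<open>p*q*u*v\<close>; only its length remains, as
      \<open>fps_X\<close>.\<close>
    moreover have "gf (\<lambda>\<sigma>. weight p q 1 v s t (tl \<sigma>)) (max_at k 0 top_right) =
        fps_const 1 * fps_X * (F_gf k p q 1 v s t - 1)"
      by (rule gf_Cons_max) (use i in auto)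
    ultimately show ?thesis
      by (simp add: gf_separables_length mult_ac fps_const_mult[symmetric] del: fps_const_mult)
  qed
  also have "(\<Sum>j=1..i-1. gf ?W (?U j)) =
      (\<Sum>j=1..i-1. fps_const p * fps_const (X_poly j p q u 1 1 1) * fps_X ^ j * f_gf k (i - j) p q u v s t)"
  proof (rule sum.cong[OF refl])
    fix j assume "j \<in> {1..i-1}"
    then have j: "1 \<le> j" "j \<le> i" "j < i" by auto
    have "gf ?W (?U j) = fps_const p * fps_X ^ 0 *
        gf (weight p q u 1 1 1) {\<rho> \<in> separables. length \<rho> = j} * gf ?W (max_at k (i - j) top_right)"
      by (rule gf_prod[OF bij_insert_left[OF j(1,2) i(2)]])
        (rule graded_finite_intros insert_left_weights(1,2) j | assumption)+
    then show "gf ?W (?U j) =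
        fps_const p * fps_const (X_poly j p q u 1 1 1) * fps_X ^ j * f_gf k (i - j) p q u v s t"
      using i j by (simp add: gf_separables_length f_gf_eq max_before_next_pos mult.assoc del: fps_const_mult)
  qed
  finally show ?thesis unfolding max_at_left_decomp .
qed

text \<open>If the maximum comes last, all of the left side is above the empty right side and no
  block is singled out, so this case is summed directly. It is the term subtracted from
  \<open>g_gf\<close> in the final recursion.\<close>

lemma g_gf_split:
  "g_gf k i p q u v s t =
    fps_const (p*u*v*t) * fps_X ^ (i + 1) * fps_const (X_poly i p q u 1 s t) +
    gf (weight p q u v s t) (max_at k i (\<lambda>X Y. top_left X Y \<and> (Y = {} \<longleftrightarrow> False)))"
proof -
  let ?S = "\<lambda>b. max_at k i (\<lambda>X Y. top_left X Y \<and> (Y = {} \<longleftrightarrow> b))"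
  have "g_gf k i p q u v s t = gf (weight p q u v s t) (max_at k i top_left)"
    using i by (simp add: g_gf_eq max_after_next_eq)
  also have "\<dots> = gf (weight p q u v s t) (?S True) + gf (weight p q u v s t) (?S False)"
    by (rule gf_max_at_split)
  finally show ?thesis by (simp only: gf_max_last)
qed

end

theorem theorem3p1:
  fixes p q u v s t :: "'a :: field" and k :: nat
  assumes "k \<ge> 2"
  shows
    "F_gf k p q u v s t = 1 + (\<Sum>i=0..k-2. f_gf k i p q u v s t + g_gf k i p q u v s t)
   \<and> (\<forall>i. 1 \<le> i \<and> i \<le> k - 2 \<longrightarrow>
        f_gf k i p q u v s t =
            fps_const (p*q*u*v) * fps_X^(i+1) * fps_const (X_poly i p q u 1 s t)
              * (F_gf (k-i) p q 1 v 1 t - 1)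
          + fps_const (p*q^2*u*v) * fps_X^(i+1) * fps_const (X_poly i p q u 1 s 1)
              * (F_gf (k-i) p q 1 v 1 1 - 1) * (F_gf k p q 1 v s t - 1)
          + fps_const (p*q) * (F_gf (k-i) p q 1 v 1 1 - 1)
              * (\<Sum>j=1..i-1. fps_const (X_poly j p q u 1 1 1) * fps_X^j
                            * f_gf k (i-j) p q u v s t))
   \<and> (\<forall>i. 1 \<le> i \<and> i \<le> k - 2 \<longrightarrow>
        g_gf k i p q u v s t =
            fps_const (p*u*v*t) * fps_X^(i+1) * fps_const (X_poly i p q u 1 s t)
          + fps_const (p*q*u*v) * fps_X^(i+1) * fps_const (X_poly i p q u 1 s 1)
              * (F_gf k p q 1 v s t - 1)
          + fps_const (p^2*q*u*v) * fps_X^(i+1)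
              * (\<Sum>j=1..i-1. fps_const (X_poly j p q u 1 1 1)
                            * fps_const (X_poly (i-j) p q u 1 s t)
                            * (F_gf (k-i+j) p q 1 v 1 t - 1))
          + fps_const (p*q)
              * (\<Sum>j=1..i-1. fps_const (X_poly j p q u 1 1 1) * fps_X^j
                            * (F_gf (k-i+j) p q 1 v 1 1 - 1)
                            * (g_gf k (i-j) p q u v s t
                                 - fps_const (p*u*v*t) * fps_X^(i-j+1)
                                     * fps_const (X_poly (i-j) p q u 1 s t))))
   \<and> f_gf k 0 p q u v s t =
        fps_const (u*v*s*t) * fps_X
        + fps_const (q*u*v*s) * fps_X * (F_gf k p q 1 v s t - 1)
   \<and> g_gf k 0 p q u v s t = 0
   \<and> f_gf 2 0 p q u v s t =
        fps_const (u*v*s*t) * fps_X / (1 - fps_const (q*v*s) * fps_X)"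
proof (intro conjI allI impI)
  show "F_gf k p q u v s t = 1 + (\<Sum>i=0..k-2. f_gf k i p q u v s t + g_gf k i p q u v s t)"
    by (rule F_gf_decomp[OF assms])
next
  fix i assume i: "1 \<le> i \<and> i \<le> k - 2"
  then have i': "1 \<le> i" "i + 1 < k" by auto
  show "f_gf k i p q u v s t =
            fps_const (p*q*u*v) * fps_X^(i+1) * fps_const (X_poly i p q u 1 s t)
              * (F_gf (k-i) p q 1 v 1 t - 1)
          + fps_const (p*q^2*u*v) * fps_X^(i+1) * fps_const (X_poly i p q u 1 s 1)
              * (F_gf (k-i) p q 1 v 1 1 - 1) * (F_gf k p q 1 v s t - 1)
          + fps_const (p*q) * (F_gf (k-i) p q 1 v 1 1 - 1)
              * (\<Sum>j=1..i-1. fps_const (X_poly j p q u 1 1 1) * fps_X^j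
                            * f_gf k (i-j) p q u v s t)"
    \<comment> \<open>One recursion substituted into the other; the constant \<open>p\<close> of
      each term is drawn out of the sum over \<open>j\<close>.\<close>
    unfolding f_gf_rec[OF i'] gf_left_rec[OF i'] mult.assoc[of "fps_const p"] sum_distrib_left[symmetric]
    by (simp add: fps_const_mult[symmetric] power2_eq_square algebra_simps del: fps_const_mult)
next
  fix i assume i: "1 \<le> i \<and> i \<le> k - 2"
  then have i': "1 \<le> i" "i + 1 < k" by auto
  \<comment> \<open>\<open>f_gf k (i - j)\<close> is expanded once more by \<open>f_gf_rec\<close>.
    The series of permutations with an entry behind the maximum that appears there is
    \<open>g_gf k (i - j)\<close> minus its part with the maximum last.\<close>
  have "fps_const p * fps_const (X_poly j p q u 1 1 1) * fps_X ^ j * f_gf k (i - j) p q u v s t =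
      fps_const (p^2*q*u*v) * fps_X^(i+1) * (fps_const (X_poly j p q u 1 1 1)
          * fps_const (X_poly (i-j) p q u 1 s t) * (F_gf (k-i+j) p q 1 v 1 t - 1))
      + fps_const (p*q) * (fps_const (X_poly j p q u 1 1 1) * fps_X^j
          * (F_gf (k-i+j) p q 1 v 1 1 - 1) * (g_gf k (i-j) p q u v s t
              - fps_const (p*u*v*t) * fps_X^(i-j+1) * fps_const (X_poly (i-j) p q u 1 s t)))"
    if "j \<in> {1..i-1}" for j
  proof -
    have j: "1 \<le> i - j" "(i - j) + 1 < k" "k - (i - j) = k - i + j" "i + 1 = j + (i - j + 1)"
      using that i' by auto
    \<comment> \<open>The block takes \<open>j\<close> powers of \<open>fps_X\<close>; the others
      belong to the permutation from which it was removed.\<close>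
    have eqX: "fps_X ^ (i + 1) = fps_X ^ j * (fps_X ^ (i - j + 1) :: 'a fps)"
      by (subst j(4)) (rule power_add)
    show ?thesis
      unfolding f_gf_rec[OF j(1,2)] g_gf_split[OF j(1,2)] eqX j(3)
      by (simp add: fps_const_mult[symmetric] power2_eq_square algebra_simps
          del: fps_const_mult power_Suc)
  qed
  then have "(\<Sum>j=1..i-1. fps_const p * fps_const (X_poly j p q u 1 1 1) * fps_X ^ j
        * f_gf k (i - j) p q u v s t) =
      fps_const (p^2*q*u*v) * fps_X^(i+1)
              * (\<Sum>j=1..i-1. fps_const (X_poly j p q u 1 1 1)
                            * fps_const (X_poly (i-j) p q u 1 s t)
                            * (F_gf (k-i+j) p q 1 v 1 t - 1))
          + fps_const (p*q)
              * (\<Sum>j=1..i-1. fps_const (X_poly j p q u 1 1 1) * fps_X^j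
                            * (F_gf (k-i+j) p q 1 v 1 1 - 1)
                            * (g_gf k (i-j) p q u v s t
                                 - fps_const (p*u*v*t) * fps_X^(i-j+1)
                                     * fps_const (X_poly (i-j) p q u 1 s t)))"
    unfolding sum_distrib_left sum.distrib[symmetric] by (rule sum.cong[OF refl])
  then show "g_gf k i p q u v s t =
            fps_const (p*u*v*t) * fps_X^(i+1) * fps_const (X_poly i p q u 1 s t)
          + fps_const (p*q*u*v) * fps_X^(i+1) * fps_const (X_poly i p q u 1 s 1)
              * (F_gf k p q 1 v s t - 1)
          + fps_const (p^2*q*u*v) * fps_X^(i+1)
              * (\<Sum>j=1..i-1. fps_const (X_poly j p q u 1 1 1)
                            * fps_const (X_poly (i-j) p q u 1 s t)
                            * (F_gf (k-i+j) p q 1 v 1 t - 1))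
          + fps_const (p*q)
              * (\<Sum>j=1..i-1. fps_const (X_poly j p q u 1 1 1) * fps_X^j
                            * (F_gf (k-i+j) p q 1 v 1 1 - 1)
                            * (g_gf k (i-j) p q u v s t
                                 - fps_const (p*u*v*t) * fps_X^(i-j+1)
                                     * fps_const (X_poly (i-j) p q u 1 s t)))"
    unfolding g_gf_split[OF i'] gf_left_rec[OF i'] by (simp only: add.assoc)
next
  show "f_gf k 0 p q u v s t = fps_const (u*v*s*t) * fps_X
        + fps_const (q*u*v*s) * fps_X * (F_gf k p q 1 v s t - 1)"
    by (rule f_gf_0[OF assms])
next
  show "g_gf k 0 p q u v s t = 0" using assms by (simp add: g_gf_0)
next
  \<comment> \<open>The series on the right of \<open>f_gf_0\<close> has \<open>u = 1\<close>, so
    the equation becomes self-referential only at \<open>u = 1\<close>. A general \<open>u\<close>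
    is then a mere factor.\<close>
  let ?\<phi> = "f_gf 2 0 p q 1 v s t"
  let ?d = "1 - fps_const (q*v*s) * fps_X :: 'a fps"
  \<comment> \<open>For \<open>k = 2\<close> the maximum must come first, so only
    \<open>i = 0\<close> remains, and there \<open>g_gf\<close> vanishes.\<close>
  have F: "F_gf 2 p q 1 v s t - 1 = ?\<phi>"
    using F_gf_decomp[of 2 p q 1 v s t] by (simp add: g_gf_0)
  have f: "f_gf 2 0 p q u v s t = fps_const u * (fps_const (v*s*t) * fps_X + fps_const (q*v*s) * fps_X * ?\<phi>)"
    using f_gf_0[of 2 p q u v s t] unfolding F
    by (simp add: fps_const_mult[symmetric] algebra_simps del: fps_const_mult)
  have \<phi>: "?\<phi> = fps_const (v*s*t) * fps_X + fps_const (q*v*s) * fps_X * ?\<phi>"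
    using f_gf_0[of 2 p q 1 v s t] unfolding F by simp
  have "f_gf 2 0 p q u v s t = fps_const u * ?\<phi>"
    unfolding f using \<phi> by simp
  moreover have "?\<phi> * ?d = fps_const (v*s*t) * fps_X"
    using \<phi> by (simp add: algebra_simps)
  ultimately have "f_gf 2 0 p q u v s t * ?d = fps_const (u*v*s*t) * fps_X"
    by (simp add: fps_const_mult[symmetric] mult.assoc del: fps_const_mult)
  moreover have "?d \<noteq> 0"
  proof
    assume "?d = 0"
    then have "fps_nth ?d 0 = 0" by simp
    then show False by simp
  qed
  ultimately show "f_gf 2 0 p q u v s t = fps_const (u*v*s*t) * fps_X / ?d"
    by (metis nonzero_mult_div_cancel_right)
qed

end
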